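(* Let $p=p(k)\ge2$ be such that $p/k$ converges to some $\beta\in[0,\infty]$ as $k\to\infty$. For the broom $\mathcal B_{k,p}$, let $B_1$ be the number of Braess edges joining two vertices of the star part, $B_2$ the number of Braess edges joining a vertex of the path part to a pendent vertex of the star part, and $B_3$ the number of Braess edges joining two vertices of the path part. Then $$B_1=\frac{p(p-1)}2,\qquad B_2=O(k),\qquad B_3=\Theta(k\ln k)$$ as $k\to\infty$. Consequently, as $k\to\infty$, $B(\mathcal B_{k,p})=\Theta(k\ln k+p^2)$ if $p/k\to0$, and $B(\mathcal B_{k,p})\sim\frac12p^2$ if $p/k\to\beta\in(0,\infty]$.
   Context: For $k\ge3$ (path part) and $p\ge2$, the broom $\mathcal B_{k,p}$ is obtained from the path $\mathcal P_k=(1,\dots,k)$ and a star $\mathcal S_{1,p}$ with $p$ leaves by identifying vertex $k$ of the path with the center of the star; so vertex $k$ has $p$ pendent neighbours (the pendent vertices of the star part) and $\mathcal B_{k,p}$ has $k+p$ vertices. For a connected graph $G$, $\kappa(G)$ is Kemeny's constant of the simple random walk on $G$: $\kappa(G)=\sum_{j\ne i}m_{ij}\pi_j$ ($m_{ij}$ mean first passage time, $\pi$ stationary distribution). A pair of nonadjacent vertices is a Braess edge of $G$ if adding the edge between them strictly increases $\kappa$; $B(G)$ is the number of Braess edges of $G$. *)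

theory Defs
  imports "HOL-Library.Extended_Real" "HOL-Library.Landau_Symbols"
begin

text \<open>
  A finite simple graph is given by its vertex set \<open>V\<close> and its set \<open>E\<close> of edges, each edge being
  a two-element subset of \<open>V\<close>.
\<close>

definition vertex_degree :: "'a set \<Rightarrow> 'a set set \<Rightarrow> 'a \<Rightarrow> nat" where
  "vertex_degree V E u = card {v \<in> V. {u, v} \<in> E}"

definition walk_prob :: "'a set \<Rightarrow> 'a set set \<Rightarrow> 'a \<Rightarrow> 'a \<Rightarrow> real" where
  "walk_prob V E u v = (if {u, v} \<in> E then 1 / real (vertex_degree V E u) else 0)"

definition is_stationary :: "'a set \<Rightarrow> 'a set set \<Rightarrow> ('a \<Rightarrow> real) \<Rightarrow> bool" where
  "is_stationary V E \<pi> \<longleftrightarrow>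
     (\<forall>v\<in>V. 0 \<le> \<pi> v) \<and> (\<Sum>v\<in>V. \<pi> v) = 1 \<and>
     (\<forall>v\<in>V. (\<Sum>u\<in>V. \<pi> u * walk_prob V E u v) = \<pi> v)"

text \<open>
  The value 0 is imposed outside \<open>V\<close> because otherwise a total function \<open>\<pi>\<close> would not be unique.
  For connected graphs with at least two vertices the description is proper.
\<close>

definition stationary_distr :: "'a set \<Rightarrow> 'a set set \<Rightarrow> 'a \<Rightarrow> real" where
  "stationary_distr V E = (THE \<pi>. is_stationary V E \<pi> \<and> (\<forall>v. v \<notin> V \<longrightarrow> \<pi> v = 0))"

text \<open>
  \<open>first_passage_prob V E j n i\<close> is the probability that the simple random walk \<open>X\<close> started at
  \<open>X\<^sub>0 = i\<close> visits \<open>j\<close> for the first time (at a positive time) at time \<open>n\<close>, that is, the probability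
  of \<open>X\<^sub>n = j\<close> and \<open>X\<^sub>m \<noteq> j\<close> for \<open>1 \<le> m < n\<close>; the recursion conditions on \<open>X\<^sub>1\<close>.
\<close>

fun first_passage_prob :: "'a set \<Rightarrow> 'a set set \<Rightarrow> 'a \<Rightarrow> nat \<Rightarrow> 'a \<Rightarrow> real" where
  "first_passage_prob V E j 0 i = 0"
| "first_passage_prob V E j (Suc 0) i = walk_prob V E i j"
| "first_passage_prob V E j (Suc (Suc n)) i =
     (\<Sum>l\<in>V - {j}. walk_prob V E i l * first_passage_prob V E j (Suc n) l)"

definition mean_first_passage :: "'a set \<Rightarrow> 'a set set \<Rightarrow> 'a \<Rightarrow> 'a \<Rightarrow> real" where
  "mean_first_passage V E i j = (\<Sum>n. real n * first_passage_prob V E j n i)"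

text \<open>
  For a connected graph the sum below does not depend on the starting vertex \<open>i\<close>;
  Kemeny's constant is the common value.
\<close>

definition kemeny :: "'a set \<Rightarrow> 'a set set \<Rightarrow> real" where
  "kemeny V E =
     (THE c. \<forall>i\<in>V. (\<Sum>j\<in>V - {i}. mean_first_passage V E i j * stationary_distr V E j) = c)"

definition braess_edges :: "'a set \<Rightarrow> 'a set set \<Rightarrow> 'a set set" where
  "braess_edges V E =
     {{u, v} | u v. u \<in> V \<and> v \<in> V \<and> u \<noteq> v \<and> {u, v} \<notin> E \<and>
        kemeny V (insert {u, v} E) > kemeny V E}"

definition braess_edges_between :: "'a set \<Rightarrow> 'a set set \<Rightarrow> 'a set \<Rightarrow> 'a set \<Rightarrow> 'a set set" where
  "braess_edges_between V E A B = {e \<in> braess_edges V E. \<exists>u\<in>A. \<exists>v\<in>B. e = {u, v}}"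

text \<open>
  In the broom the path is \<open>1, \<dots>, k\<close> and the pendent vertices of the star part
  are \<open>k + 1, \<dots>, k + p\<close>; the centre \<open>k\<close> belongs to both the path part and the star part.
\<close>

definition broom_path :: "nat \<Rightarrow> nat set" where
  "broom_path k = {1..k}"

definition broom_pendents :: "nat \<Rightarrow> nat \<Rightarrow> nat set" where
  "broom_pendents k p = {k + 1..k + p}"

definition broom_star :: "nat \<Rightarrow> nat \<Rightarrow> nat set" where
  "broom_star k p = insert k (broom_pendents k p)"

definition broom_verts :: "nat \<Rightarrow> nat \<Rightarrow> nat set" where
  "broom_verts k p = broom_path k \<union> broom_star k p"

definition broom_edges :: "nat \<Rightarrow> nat \<Rightarrow> nat set set" where
  "broom_edges k p = {{i, i + 1} | i. 1 \<le> i \<and> i < k} \<union> {{k, v} | v. v \<in> broom_pendents k p}"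

definition broom_B :: "nat \<Rightarrow> nat \<Rightarrow> nat" where
  "broom_B k p = card (braess_edges (broom_verts k p) (broom_edges k p))"

definition broom_B1 :: "nat \<Rightarrow> nat \<Rightarrow> nat" where
  "broom_B1 k p = card (braess_edges_between (broom_verts k p) (broom_edges k p)
     (broom_star k p) (broom_star k p))"

definition broom_B2 :: "nat \<Rightarrow> nat \<Rightarrow> nat" where
  "broom_B2 k p = card (braess_edges_between (broom_verts k p) (broom_edges k p)
     (broom_path k) (broom_pendents k p))"

definition broom_B3 :: "nat \<Rightarrow> nat \<Rightarrow> nat" where
  "broom_B3 k p = card (braess_edges_between (broom_verts k p) (broom_edges k p)
     (broom_path k) (broom_path k))"

end

theory Submission
  imports Defs "HOL-Analysis.Harmonic_Numbers" "HOL-Real_Asymp.Real_Asymp"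
begin

text \<open>
  Kemeny's constant of a connected graph is \<open>(\<Sum>x y. d x * d y * r x y) / (2 * (\<Sum>x. d x))\<close>, where
  \<open>d\<close> is the degree and \<open>r\<close> the effective resistance. Adding an edge \<open>{u, v}\<close> changes \<open>r\<close> by an explicit
  rank-one term, so for the broom (a tree, where \<open>r\<close> is the graph distance) the sign of the change of
  Kemeny's constant becomes an explicit polynomial inequality.

  Let \<open>a = k - 1\<close>. Two pendent vertices always give a Braess edge. A chord of the path part that bridges
  \<open>l\<close> edges and leaves \<open>b\<close> edges on the left and \<open>c\<close> on the right can be Braess only if \<open>b * l\<close> or \<open>c * l\<close>
  is at most \<open>3 * a + 1\<close>, and it is Braess if \<open>5 * l\<^sup>2 \<le> a\<close> and \<open>9 * b * l \<le> a\<close>; summing \<open>a / l\<close> over \<open>l\<close> gives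
  the order \<open>k * ln k\<close>, uniformly in \<open>p\<close>. A chord from the path part to a pendent vertex that closes
  a cycle of length \<open>l + 1\<close> can be Braess only if \<open>(p - 1) * l < 4 * k\<close>, which leaves \<open>O(k)\<close> of them.
\<close>

section \<open>Hitting times and Kemeny's constant\<close>

definition adj :: "'a set set \<Rightarrow> 'a \<Rightarrow> 'a \<Rightarrow> real" where
  "adj E x y = (if {x, y} \<in> E then 1 else 0)"

definition laplacian :: "'a set \<Rightarrow> 'a set set \<Rightarrow> ('a \<Rightarrow> real) \<Rightarrow> 'a \<Rightarrow> real" where
  "laplacian V E f x = (\<Sum>y\<in>V. adj E x y * (f x - f y))"

abbreviation deg :: "'a set \<Rightarrow> 'a set set \<Rightarrow> 'a \<Rightarrow> real" where
  "deg V E x \<equiv> real (vertex_degree V E x)"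

lemma adj_nonneg: "0 \<le> adj E x y"
  by (simp add: adj_def)

lemma adj_commute: "adj E x y = adj E y x"
  by (simp add: adj_def insert_commute)

lemma deg_eq_sum_adj:
  assumes "finite V"
  shows "deg V E x = (\<Sum>y\<in>V. adj E x y)"
  using assms by (simp add: vertex_degree_def adj_def sum.If_cases Int_def)

lemma walk_prob_eq_adj: "walk_prob V E x y = adj E x y / deg V E x"
  by (simp add: walk_prob_def adj_def)

lemma laplacian_eq:
  assumes "finite V"
  shows "laplacian V E f x = deg V E x * f x - (\<Sum>y\<in>V. adj E x y * f y)"
  using assms
  by (simp add: laplacian_def deg_eq_sum_adj right_diff_distrib sum_subtractf sum_distrib_right)

lemma laplacian_self_adjoint:
  assumes "finite V"
  shows "(\<Sum>x\<in>V. f x * laplacian V E g x) = (\<Sum>x\<in>V. laplacian V E f x * g x)"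
proof -
  have "(\<Sum>x\<in>V. \<Sum>y\<in>V. f x * adj E x y * g y) = (\<Sum>x\<in>V. \<Sum>y\<in>V. f y * adj E y x * g x)"
    by (rule sum.swap)
  then have "(\<Sum>x\<in>V. f x * (\<Sum>y\<in>V. adj E x y * g y)) = (\<Sum>x\<in>V. (\<Sum>y\<in>V. adj E x y * f y) * g x)"
    by (simp add: sum_distrib_left sum_distrib_right adj_commute[of E] mult.assoc mult.left_commute mult.commute)
  then show ?thesis
    using assms by (simp add: laplacian_eq right_diff_distrib left_diff_distrib sum_subtractf mult_ac)
qed

section \<open>Mean first passage times from a Laplace equation\<close>

text \<open>Half of \<open>n * u n\<close> is at most the sum of \<open>u\<close> over
  \<open>{n div 2..<n}\<close>, a difference of two partial sums with the same limit. This removes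
  the boundary term when the mean first passage series is summed by parts.\<close>

lemma decreasing_summable_imp_mult_tendsto_0:
  fixes u :: "nat \<Rightarrow> real"
  assumes dec: "\<And>n. u (Suc n) \<le> u n" and nonneg: "\<And>n. 0 \<le> u n" and summable: "summable u"
  shows "(\<lambda>n. real n * u n) \<longlonglongrightarrow> 0"
proof -
  define U where "U n = (\<Sum>i<n. u i)" for n
  have U: "U \<longlonglongrightarrow> suminf u"
    using summable summable_LIMSEQ unfolding U_def by blast
  have "filterlim (\<lambda>n. n div 2) at_top (at_top :: nat filter)"
    unfolding filterlim_at_top
  proof
    fix Z :: nat
    show "eventually (\<lambda>n. Z \<le> n div 2) at_top"
      using eventually_ge_at_top[of "2 * Z"] by eventually_elim auto
  qed
  then have U2: "(\<lambda>n. U (n div 2)) \<longlonglongrightarrow> suminf u"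
    using U filterlim_compose by blast
  have anti: "u n \<le> u m" if "m \<le> n" for m n
    using that dec by (rule lift_Suc_antimono_le[rotated])
  have bound: "real n * u n \<le> 2 * (U n - U (n div 2))" for n
  proof -
    have "(\<Sum>i=n div 2..<n. u n) \<le> (\<Sum>i=n div 2..<n. u i)"
      by (rule sum_mono) (use anti in auto)
    moreover have "(\<Sum>i=n div 2..<n. u i) = U n - U (n div 2)"
      unfolding U_def by (simp add: sum_diff_nat_ivl lessThan_atLeast0)
    ultimately have "real (n - n div 2) * u n \<le> U n - U (n div 2)"
      by simp
    moreover have "real n / 2 * u n \<le> real (n - n div 2) * u n"
      by (rule mult_right_mono) (use nonneg in \<open>auto simp: field_simps\<close>)
    ultimately show ?thesis by (simp add: field_simps)
  qed
  have "(\<lambda>n. 2 * (U n - U (n div 2))) \<longlonglongrightarrow> 2 * (suminf u - suminf u)"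
    by (intro tendsto_intros U U2)
  then have lim: "(\<lambda>n. 2 * (U n - U (n div 2))) \<longlonglongrightarrow> 0"
    by simp
  show ?thesis
    by (rule tendsto_sandwich[OF _ _ tendsto_const lim]) (use bound nonneg in auto)
qed

text \<open>\<open>survival V E j n i\<close> is the probability that the walk from \<open>i\<close> avoids \<open>j\<close> at the times \<open>1, \<dots>, n\<close>.\<close>

primrec survival :: "'a set \<Rightarrow> 'a set set \<Rightarrow> 'a \<Rightarrow> nat \<Rightarrow> 'a \<Rightarrow> real" where
  "survival V E j 0 i = 1"
| "survival V E j (Suc n) i = (\<Sum>l\<in>V - {j}. walk_prob V E i l * survival V E j n l)"

lemma walk_prob_nonneg: "0 \<le> walk_prob V E i l"
  by (simp add: walk_prob_def)

lemma survival_nonneg: "0 \<le> survival V E j n i"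
  by (induction n arbitrary: i) (auto intro!: sum_nonneg mult_nonneg_nonneg walk_prob_nonneg)

lemma sum_walk_prob:
  assumes "finite V" "0 < vertex_degree V E i"
  shows "(\<Sum>l\<in>V. walk_prob V E i l) = 1"
  using assms by (simp add: walk_prob_eq_adj flip: sum_divide_distrib deg_eq_sum_adj)

text \<open>A first visit to \<open>j\<close> at time \<open>n + 1\<close> means avoiding
  \<open>j\<close> up to time \<open>n\<close> but not up to \<open>n + 1\<close>. Positive degrees
  make the transition probabilities sum to 1, which settles \<open>n = 0\<close>; afterwards both
  sides obey the same recursion.\<close>

lemma first_passage_prob_Suc_eq:
  assumes fin: "finite V" and pos: "\<And>x. x \<in> V \<Longrightarrow> 0 < vertex_degree V E x"
    and "j \<in> V" "i \<in> V"
  shows "first_passage_prob V E j (Suc n) i = survival V E j n i - survival V E j (Suc n) i"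
  using \<open>i \<in> V\<close>
proof (induction n arbitrary: i)
  case 0
  have "(\<Sum>l\<in>V. walk_prob V E i l) = walk_prob V E i j + (\<Sum>l\<in>V - {j}. walk_prob V E i l)"
    using fin \<open>j \<in> V\<close> by (rule sum.remove)
  then show ?case
    using sum_walk_prob[OF fin pos[OF 0]] by simp
next
  case (Suc n)
  have "first_passage_prob V E j (Suc (Suc n)) i =
      (\<Sum>l\<in>V - {j}. walk_prob V E i l * (survival V E j n l - survival V E j (Suc n) l))"
    using Suc.IH by (simp del: survival.simps(2))
  then show ?case
    by (simp add: right_diff_distrib sum_subtractf)
qed

lemma survival_Suc_le:
  assumes fin: "finite V" and pos: "\<And>x. x \<in> V \<Longrightarrow> 0 < vertex_degree V E x" and "i \<in> V"
  shows "survival V E j (Suc n) i \<le> survival V E j n i"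
  using \<open>i \<in> V\<close>
proof (induction n arbitrary: i)
  case 0
  have "(\<Sum>l\<in>V - {j}. walk_prob V E i l) \<le> (\<Sum>l\<in>V. walk_prob V E i l)"
    by (rule sum_mono2) (use fin walk_prob_nonneg in auto)
  then show ?case
    using sum_walk_prob[OF fin pos[OF 0]] by simp
next
  case (Suc n)
  show ?case
    unfolding survival.simps(2)[of V E j "Suc n"] survival.simps(2)[of V E j n]
    by (rule sum_mono, rule mult_left_mono[OF _ walk_prob_nonneg]) (use Suc.IH in auto)
qed

text \<open>The hypotheses on \<open>h\<close> are the equations of the expected hitting time of
  \<open>j\<close>. Unrolling them shows that the survival probabilities from \<open>i\<close> sum
  to \<open>h i\<close>, and summation by parts turns this sum into the defining series.\<close>

lemma mean_first_passage_eqI: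
  assumes fin: "finite V" and pos: "\<And>x. x \<in> V \<Longrightarrow> 0 < vertex_degree V E x"
    and j: "j \<in> V" and i: "i \<in> V - {j}"
    and hj: "h j = 0" and h: "\<And>x. x \<in> V - {j} \<Longrightarrow> laplacian V E h x = deg V E x"
  shows "mean_first_passage V E i j = h i"
proof -
  \<comment> \<open>Minimum principle: at a minimum other than \<open>j\<close> the Laplacian would
    be at most 0, yet it equals the positive degree.\<close>
  have h_nonneg: "0 \<le> h x" if "x \<in> V" for x
  proof -
    obtain y where y: "y \<in> V" "\<forall>z\<in>V. h y \<le> h z"
      using arg_min_if_finite(1)[OF fin, of h] arg_min_least[OF fin, of _ h] j by blast
    have "y = j"
    proof (rule ccontr)
      assume "y \<noteq> j"
      then have "laplacian V E h y = deg V E y"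
        using h y by simp
      moreover have "laplacian V E h y \<le> 0"
        unfolding laplacian_def
        by (rule sum_nonpos, rule mult_nonneg_nonpos[OF adj_nonneg]) (use y in auto)
      ultimately show False
        using pos[of y] y by simp
    qed
    then show ?thesis
      using y that hj by auto
  qed
  have step: "h x = 1 + (\<Sum>l\<in>V - {j}. walk_prob V E x l * h l)" if x: "x \<in> V - {j}" for x
  proof -
    have "(\<Sum>l\<in>V. adj E x l * h l) = (\<Sum>l\<in>V - {j}. adj E x l * h l)"
      using sum.remove[OF fin j, of "\<lambda>l. adj E x l * h l"] hj by simp
    then have "deg V E x * h x = deg V E x + (\<Sum>l\<in>V - {j}. adj E x l * h l)"
      using h[OF x] fin by (simp add: laplacian_eq)
    moreover have "0 < deg V E x"
      using pos x by simp
    ultimately show ?thesis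
      by (simp add: walk_prob_eq_adj field_simps flip: sum_divide_distrib)
  qed
  let ?u = "\<lambda>n i. survival V E j n i"
  define H where "H = Max (h ` V)"
  have hH: "h x \<le> H" if "x \<in> V" for x
    using that fin unfolding H_def by simp
  have H0: "0 \<le> H"
    using hH[OF j] hj by simp
  \<comment> \<open>The error after \<open>n\<close> unrollings is the expectation of
    \<open>h\<close> at time \<open>n\<close> on the event that \<open>j\<close> has been avoided,
    hence lies between 0 and \<open>H\<close> times the survival probability.\<close>
  have key: "(\<Sum>m<n. ?u m x) \<le> h x \<and> h x \<le> (\<Sum>m<n. ?u m x) + H * ?u n x" if "x \<in> V - {j}" for n x
    using that
  proof (induction n arbitrary: x)
    case 0
    then show ?case
      using h_nonneg hH by simp
  next
    case (Suc n)
    have eq: "(\<Sum>m<Suc n. ?u m x) = 1 + (\<Sum>l\<in>V - {j}. walk_prob V E x l * (\<Sum>m<n. ?u m l))"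
      by (subst sum.lessThan_Suc_shift) (simp add: sum_distrib_left sum.swap[of _ "{..<n}"])
    have "(\<Sum>l\<in>V - {j}. walk_prob V E x l * (\<Sum>m<n. ?u m l)) \<le> (\<Sum>l\<in>V - {j}. walk_prob V E x l * h l)"
      by (rule sum_mono, rule mult_left_mono[OF _ walk_prob_nonneg]) (use Suc.IH in auto)
    moreover have "(\<Sum>l\<in>V - {j}. walk_prob V E x l * h l)
        \<le> (\<Sum>l\<in>V - {j}. walk_prob V E x l * ((\<Sum>m<n. ?u m l) + H * ?u n l))"
      by (rule sum_mono, rule mult_left_mono[OF _ walk_prob_nonneg]) (use Suc.IH in auto)
    moreover have "(\<Sum>l\<in>V - {j}. walk_prob V E x l * ((\<Sum>m<n. ?u m l) + H * ?u n l))
        = (\<Sum>l\<in>V - {j}. walk_prob V E x l * (\<Sum>m<n. ?u m l)) + H * ?u (Suc n) x"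
      by (simp add: distrib_left sum.distrib sum_distrib_left mult_ac)
    ultimately show ?case
      using step[OF Suc.prems] eq by linarith
  qed
  have summable: "summable (\<lambda>n. ?u n i)"
  proof (rule summableI_nonneg_bounded)
    show "(\<Sum>m<n. ?u m i) \<le> h i" for n
      using key i by blast
  qed (rule survival_nonneg)
  then have u0: "(\<lambda>n. ?u n i) \<longlonglongrightarrow> 0"
    by (rule summable_LIMSEQ_zero)
  have sums: "(\<lambda>n. \<Sum>m<n. ?u m i) \<longlonglongrightarrow> h i"
  proof (rule tendsto_sandwich)
    have "(\<lambda>n. h i - H * ?u n i) \<longlonglongrightarrow> h i - H * 0"
      by (intro tendsto_intros u0)
    then show "(\<lambda>n. h i - H * ?u n i) \<longlonglongrightarrow> h i"
      by simp
    show "\<forall>\<^sub>F n in sequentially. h i - H * ?u n i \<le> (\<Sum>m<n. ?u m i)"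
      using key[OF i] by (auto simp: algebra_simps)
    show "\<forall>\<^sub>F n in sequentially. (\<Sum>m<n. ?u m i) \<le> h i"
      using key[OF i] by auto
  qed (rule tendsto_const)
  have nu: "(\<lambda>n. real n * ?u n i) \<longlonglongrightarrow> 0"
    by (rule decreasing_summable_imp_mult_tendsto_0[OF _ _ summable])
      (use survival_Suc_le[OF fin pos] survival_nonneg i in auto)
  \<comment> \<open>Summation by parts, with boundary term \<open>real N * ?u N i\<close>.\<close>
  have partial: "(\<Sum>n<Suc N. real n * first_passage_prob V E j n i) = (\<Sum>m<N. ?u m i) - real N * ?u N i" for N
  proof (induction N)
    case (Suc N)
    moreover have "first_passage_prob V E j (Suc N) i = ?u N i - ?u (Suc N) i"
      using first_passage_prob_Suc_eq[OF fin pos j] i by blast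
    ultimately show ?case
      by (simp only: sum.lessThan_Suc[of _ "Suc N"]) (simp add: algebra_simps del: survival.simps(2))
  qed simp
  have "(\<lambda>N. \<Sum>n<Suc N. real n * first_passage_prob V E j n i) \<longlonglongrightarrow> h i"
    unfolding partial using tendsto_diff[OF sums nu] by simp
  then have "(\<lambda>n. real n * first_passage_prob V E j n i) sums h i"
    unfolding sums_def by (rule LIMSEQ_imp_Suc)
  then show ?thesis
    unfolding mean_first_passage_def by (simp add: sums_iff)
qed

section \<open>Kemeny's constant from effective resistances\<close>

text \<open>
  The effective resistance \<open>r\<close> of a connected graph satisfies these axioms, with \<open>\<tau> x\<close> equal to 2 minus the
  sum of the resistances of the edges at \<open>x\<close>.
\<close>

locale resistance_network =
  fixes V :: "'a set" and E :: "'a set set" and r :: "'a \<Rightarrow> 'a \<Rightarrow> real" and \<tau> :: "'a \<Rightarrow> real"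
  assumes finite_V: "finite V"
    and V_nonempty: "V \<noteq> {}"
    and degree_pos: "\<And>x. x \<in> V \<Longrightarrow> 0 < vertex_degree V E x"
    and r_self: "\<And>x. x \<in> V \<Longrightarrow> r x x = 0"
    and r_commute: "\<And>x y. x \<in> V \<Longrightarrow> y \<in> V \<Longrightarrow> r x y = r y x"
    and laplacian_r: "\<And>x y. x \<in> V \<Longrightarrow> y \<in> V \<Longrightarrow>
      laplacian V E (\<lambda>z. r z y) x = \<tau> x - (if x = y then 2 else 0)"
begin

abbreviation d :: "'a \<Rightarrow> real" where
  "d \<equiv> deg V E"

definition volume :: real where
  "volume = (\<Sum>x\<in>V. d x)"

definition potential :: "'a \<Rightarrow> real" where
  "potential x = (\<Sum>y\<in>V. d y * r x y)"

definition energy :: real where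
  "energy = (\<Sum>x\<in>V. d x * potential x)"

lemma volume_pos: "0 < volume"
  unfolding volume_def by (rule sum_pos) (use finite_V V_nonempty degree_pos in auto)

text \<open>Pairing \<open>g\<close> with \<open>r\<close> and moving the Laplacian across expresses
  \<open>g y\<close> by a quantity independent of \<open>y\<close>. The axioms on \<open>r\<close>
  thus take the role of connectedness.\<close>

lemma harmonic_imp_constant:
  assumes "\<And>x. x \<in> V \<Longrightarrow> laplacian V E g x = 0" and "y \<in> V"
  shows "g y = (\<Sum>x\<in>V. \<tau> x * g x) / 2"
proof -
  have "0 = (\<Sum>x\<in>V. r x y * laplacian V E g x)"
    using assms by simp
  also have "\<dots> = (\<Sum>x\<in>V. laplacian V E (\<lambda>z. r z y) x * g x)"
    using finite_V by (rule laplacian_self_adjoint)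
  also have "\<dots> = (\<Sum>x\<in>V. \<tau> x * g x - (if x = y then 2 * g x else 0))"
    using laplacian_r assms by (intro sum.cong refl) (simp add: left_diff_distrib)
  also have "\<dots> = (\<Sum>x\<in>V. \<tau> x * g x) - 2 * g y"
    using finite_V assms by (simp add: sum_subtractf)
  finally show ?thesis by simp
qed

text \<open>If \<open>\<pi>\<close> is stationary, \<open>\<pi> x / d x\<close> is harmonic, hence
  constant, and normalization fixes the constant. The converse is the symmetry of
  \<open>adj\<close>.\<close>

lemma is_stationary_iff:
  "is_stationary V E \<pi> \<longleftrightarrow> (\<forall>x\<in>V. \<pi> x = d x / volume)"
proof
  assume st: "is_stationary V E \<pi>"
  define g where "g x = \<pi> x / d x" for x
  have "laplacian V E g x = 0" if "x \<in> V" for x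
  proof -
    have "(\<Sum>y\<in>V. adj E x y * g y) = (\<Sum>y\<in>V. \<pi> y * walk_prob V E y x)"
      by (simp add: g_def walk_prob_eq_adj adj_commute[of E x] mult.commute)
    also have "\<dots> = \<pi> x"
      using st that by (simp add: is_stationary_def)
    finally show ?thesis
      using degree_pos[OF that] finite_V by (simp add: laplacian_eq g_def)
  qed
  then obtain c where "\<And>x. x \<in> V \<Longrightarrow> g x = c"
    using harmonic_imp_constant[of g] by metis
  then have \<pi>: "\<pi> x = c * d x" if "x \<in> V" for x
    using degree_pos[OF that] that by (force simp: g_def field_simps)
  then have "1 = c * volume"
    using st by (simp add: is_stationary_def volume_def sum_distrib_left)
  then have "c = 1 / volume"
    using volume_pos by (simp add: field_simps)
  then show "\<forall>x\<in>V. \<pi> x = d x / volume"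
    using \<pi> by simp
next
  assume \<pi>: "\<forall>x\<in>V. \<pi> x = d x / volume"
  have "(\<Sum>y\<in>V. \<pi> y * walk_prob V E y x) = \<pi> x" if "x \<in> V" for x
  proof -
    have "(\<Sum>y\<in>V. \<pi> y * walk_prob V E y x) = (\<Sum>y\<in>V. adj E x y / volume)"
      by (rule sum.cong) (use \<pi> degree_pos in \<open>auto simp: walk_prob_eq_adj adj_commute[of E x]\<close>)
    then show ?thesis
      using \<pi> that finite_V by (simp add: deg_eq_sum_adj sum_divide_distrib)
  qed
  moreover have "(\<Sum>x\<in>V. \<pi> x) = 1"
    using \<pi> volume_pos by (simp add: volume_def flip: sum_divide_distrib)
  ultimately show "is_stationary V E \<pi>"
    using \<pi> volume_pos by (auto simp: is_stationary_def)
qed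

lemma stationary_distr_eq:
  assumes "x \<in> V"
  shows "stationary_distr V E x = d x / volume"
proof -
  have "stationary_distr V E = (\<lambda>x. if x \<in> V then d x / volume else 0)"
    unfolding stationary_distr_def
    by (rule the_equality) (auto simp: is_stationary_iff)
  then show ?thesis
    using assms by simp
qed

text \<open>In the Laplacian of \<open>r x j - r x k\<close> the terms \<open>\<tau> x\<close>
  cancel, and for \<open>x \<noteq> j\<close> only the value 2 at \<open>x = k\<close> remains.
  Weighting by \<open>d k / 2\<close> gives \<open>d x\<close>, as
  \<open>mean_first_passage_eqI\<close> requires.\<close>

lemma mean_first_passage_eq:
  assumes "i \<in> V" "j \<in> V" "i \<noteq> j"
  shows "mean_first_passage V E i j = (\<Sum>k\<in>V. d k * (r i j + r j k - r i k)) / 2"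
proof (rule mean_first_passage_eqI[OF finite_V degree_pos])
  let ?h = "\<lambda>i. (\<Sum>k\<in>V. d k * (r i j + r j k - r i k)) / 2"
  show "?h j = 0"
    using assms r_self by simp
  show "laplacian V E ?h x = d x" if x: "x \<in> V - {j}" for x
  proof -
    have "?h x - ?h y = (\<Sum>k\<in>V. d k * ((r x j - r y j) - (r x k - r y k)) / 2)" for y
      unfolding diff_divide_distrib[symmetric] sum_subtractf[symmetric] sum_divide_distrib
      by (intro sum.cong refl) (simp add: algebra_simps)
    then have "laplacian V E ?h x =
        (\<Sum>y\<in>V. \<Sum>k\<in>V. adj E x y * (d k * ((r x j - r y j) - (r x k - r y k)) / 2))"
      by (simp add: laplacian_def sum_distrib_left)
    also have "\<dots> = (\<Sum>k\<in>V. \<Sum>y\<in>V. adj E x y * (d k * ((r x j - r y j) - (r x k - r y k)) / 2))"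
      by (rule sum.swap)
    also have "\<dots> = (\<Sum>k\<in>V. d k / 2 * (laplacian V E (\<lambda>z. r z j) x - laplacian V E (\<lambda>z. r z k) x))"
      unfolding laplacian_def sum_subtractf[symmetric] sum_distrib_left
      by (intro sum.cong refl) (simp add: field_simps)
    also have "\<dots> = (\<Sum>k\<in>V. if x = k then d k else 0)"
      using x assms by (intro sum.cong refl) (simp add: laplacian_r)
    also have "\<dots> = d x"
      using x finite_V by simp
    finally show ?thesis .
  qed
qed (use assms in auto)

text \<open>In the weighted sum over \<open>j\<close> the terms that depend on \<open>i\<close> are
  \<open>potential i * volume\<close> with opposite signs, so all starting vertices give the same
  value.\<close>

theorem kemeny_eq: "kemeny V E = energy / (2 * volume)"
proof -
  have "(\<Sum>j\<in>V - {i}. mean_first_passage V E i j * stationary_distr V E j) = energy / (2 * volume)"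
    if i: "i \<in> V" for i
  proof -
    have "(\<Sum>j\<in>V - {i}. mean_first_passage V E i j * stationary_distr V E j)
        = (\<Sum>j\<in>V - {i}. (\<Sum>k\<in>V. d k * (r i j + r j k - r i k)) / 2 * (d j / volume))"
      by (rule sum.cong) (use i in \<open>auto simp: mean_first_passage_eq stationary_distr_eq\<close>)
    \<comment> \<open>The term \<open>j = i\<close> can be added, being zero by
      \<open>r i i = 0\<close>.\<close>
    also have "\<dots> = (\<Sum>j\<in>V. (\<Sum>k\<in>V. d k * (r i j + r j k - r i k)) / 2 * (d j / volume))"
      using sum.remove[OF finite_V i, of "\<lambda>j. (\<Sum>k\<in>V. d k * (r i j + r j k - r i k)) / 2 * (d j / volume)"]
        r_self[OF i] by simp
    also have "\<dots> = (\<Sum>j\<in>V. d j * (r i j * volume + potential j - potential i)) / (2 * volume)"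
    proof -
      have "(\<Sum>k\<in>V. d k * (r i j + r j k - r i k)) = r i j * volume + potential j - potential i" for j
        by (simp add: potential_def volume_def algebra_simps sum.distrib sum_subtractf sum_distrib_left)
      then show ?thesis
        unfolding sum_divide_distrib[of _ V "2 * volume"]
        by (intro sum.cong refl) (simp add: mult.commute)
    qed
    also have "(\<Sum>j\<in>V. d j * (r i j * volume + potential j - potential i)) = energy"
    proof -
      have "(\<Sum>j\<in>V. d j * (r i j * volume)) = potential i * volume"
        by (simp add: potential_def sum_distrib_right mult.assoc)
      moreover have "(\<Sum>j\<in>V. d j * potential i) = potential i * volume"
        by (simp add: volume_def sum_distrib_left mult.commute)
      ultimately show ?thesis
        by (simp add: algebra_simps sum.distrib sum_subtractf energy_def)
    qed
    finally show ?thesis .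
  qed
  then show ?thesis
    unfolding kemeny_def using V_nonempty by (intro the_equality) auto
qed

end

section \<open>Adding an edge\<close>

lemma adj_insert:
  assumes "u \<noteq> v" "{u, v} \<notin> E"
  shows "adj (insert {u, v} E) x y =
    adj E x y + (if x = u \<and> y = v then 1 else 0) + (if x = v \<and> y = u then 1 else 0)"
  using assms by (auto simp: adj_def doubleton_eq_iff insert_commute)

lemma sum_adj_insert:
  assumes "finite V" "u \<in> V" "v \<in> V" "u \<noteq> v" "{u, v} \<notin> E"
  shows "(\<Sum>y\<in>V. adj (insert {u, v} E) x y * g y) =
    (\<Sum>y\<in>V. adj E x y * g y) + (if x = u then g v else 0) + (if x = v then g u else 0)"
proof -
  have "(\<Sum>y\<in>V. adj (insert {u, v} E) x y * g y) = (\<Sum>y\<in>V. adj E x y * g y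
      + (if y = v then if x = u then g v else 0 else 0) + (if y = u then if x = v then g u else 0 else 0))"
    by (rule sum.cong) (use adj_insert[OF assms(4,5)] in \<open>auto simp: algebra_simps\<close>)
  then show ?thesis
    using assms by (simp add: sum.distrib)
qed

lemma deg_insert:
  assumes "finite V" "u \<in> V" "v \<in> V" "u \<noteq> v" "{u, v} \<notin> E"
  shows "deg V (insert {u, v} E) x = deg V E x + (if x = u then 1 else 0) + (if x = v then 1 else 0)"
  using sum_adj_insert[OF assms, of x "\<lambda>_. 1"] assms(1) by (simp add: deg_eq_sum_adj)

lemma laplacian_insert:
  assumes "finite V" "u \<in> V" "v \<in> V" "u \<noteq> v" "{u, v} \<notin> E"
  shows "laplacian V (insert {u, v} E) g x = laplacian V E g x
    + (if x = u then g u - g v else 0) + (if x = v then g v - g u else 0)"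
  using sum_adj_insert[OF assms, of x "\<lambda>y. g x - g y"] assms(4) by (simp add: laplacian_def)

lemma laplacian_cmult: "laplacian V E (\<lambda>z. c * f z) x = c * laplacian V E f x"
  unfolding laplacian_def sum_distrib_left by (intro sum.cong refl) (simp add: algebra_simps)

lemma laplacian_diff: "laplacian V E (\<lambda>z. f z - g z) x = laplacian V E f x - laplacian V E g x"
  unfolding laplacian_def sum_subtractf[symmetric] by (intro sum.cong refl) (simp add: algebra_simps)

lemma laplacian_shifted_square:
  "laplacian V E (\<lambda>z. (f z - c)\<^sup>2) x = laplacian V E (\<lambda>z. (f z)\<^sup>2) x - 2 * c * laplacian V E f x"
  unfolding laplacian_def sum_distrib_left sum_subtractf[symmetric]
  by (intro sum.cong refl) (simp add: algebra_simps power2_eq_square)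

section \<open>The rank-one update of resistance, energy and Kemeny's constant\<close>

locale resistance_network_insert = resistance_network +
  fixes u v :: 'a
  assumes u: "u \<in> V" and v: "v \<in> V" and u_neq_v: "u \<noteq> v" and not_edge: "{u, v} \<notin> E"
    and r_nonneg: "0 \<le> r u v"
begin

text \<open>The potential of a unit current from \<open>v\<close> to \<open>u\<close>.\<close>

definition f :: "'a \<Rightarrow> real" where
  "f x = (r x u - r x v) / 2"

lemmas insert_facts = finite_V u v u_neq_v not_edge

lemma f_u: "f u = - r u v / 2" and f_v: "f v = r u v / 2"
  using r_self[OF u] r_self[OF v] r_commute[OF u v] by (auto simp: f_def)

lemma laplacian_f:
  assumes "x \<in> V"
  shows "laplacian V E f x = (if x = v then 1 else 0) - (if x = u then 1 else 0)"
proof -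
  have "laplacian V E (\<lambda>z. 1 / 2 * (r z u - r z v)) x
      = (if x = v then 1 else 0) - (if x = u then 1 else 0)"
    unfolding laplacian_cmult laplacian_diff using assms u v by (simp add: laplacian_r)
  then show ?thesis
    by (simp add: f_def[abs_def])
qed

text \<open>Sherman-Morrison update of the resistance. The Laplacian of the square of
  \<open>f\<close> does not depend on \<open>y\<close> and is absorbed into the new
  \<open>\<tau>\<close>; the cross term lives on \<open>u\<close> and \<open>v\<close> only and is
  cancelled by the contribution of the new edge.\<close>

sublocale ins: resistance_network V "insert {u, v} E"
  "\<lambda>x y. r x y - (f x - f y)\<^sup>2 / (1 + r u v)"
  "\<lambda>x. \<tau> x - laplacian V E (\<lambda>z. (f z)\<^sup>2) x / (1 + r u v)"
proof
  fix x assume x: "x \<in> V"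
  have "0 < deg V (insert {u, v} E) x"
    unfolding deg_insert[OF insert_facts] using degree_pos[OF x] by simp
  then show "0 < vertex_degree V (insert {u, v} E) x"
    by simp
  show "r x x - (f x - f x)\<^sup>2 / (1 + r u v) = 0"
    using r_self x by simp
  fix y assume y: "y \<in> V"
  show "r x y - (f x - f y)\<^sup>2 / (1 + r u v) = r y x - (f y - f x)\<^sup>2 / (1 + r u v)"
    using r_commute x y by (simp add: power2_commute)
  let ?s = "1 + r u v"
  let ?r = "\<lambda>z. r z y - (f z - f y)\<^sup>2 / ?s"
  have "laplacian V E ?r x = laplacian V E (\<lambda>z. r z y - 1 / ?s * (f z - f y)\<^sup>2) x"
    by simp
  also have "\<dots> = \<tau> x - (if x = y then 2 else 0)
      - (laplacian V E (\<lambda>z. (f z)\<^sup>2) x - 2 * f y * laplacian V E f x) / ?s"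
    unfolding laplacian_diff laplacian_cmult laplacian_shifted_square using x y
    by (simp add: laplacian_r)
  finally have lap: "laplacian V E ?r x = \<tau> x - (if x = y then 2 else 0)
      - (laplacian V E (\<lambda>z. (f z)\<^sup>2) x - 2 * f y * laplacian V E f x) / ?s" .
  \<comment> \<open>The Laplacian of \<open>f\<close> is -1 at \<open>u\<close> and 1 at
    \<open>v\<close>, so this drop is exactly what cancels the cross term
    \<open>2 * f y * laplacian V E f x\<close>.\<close>
  have "?r u - ?r v = 2 * f y / ?s"
  proof -
    have "r u y - r v y = 2 * f y"
      using r_commute u v y by (simp add: f_def)
    then have "?r u - ?r v = 2 * f y - ((f u - f y)\<^sup>2 - (f v - f y)\<^sup>2) / ?s"
      by (simp add: diff_divide_distrib)
    also have "(f u - f y)\<^sup>2 - (f v - f y)\<^sup>2 = 2 * f y * r u v"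
      by (simp add: f_u f_v power2_eq_square algebra_simps)
    also have "2 * f y - 2 * f y * r u v / ?s = 2 * f y / ?s"
      using r_nonneg by (simp add: field_simps)
    finally show ?thesis .
  qed
  then show "laplacian V (insert {u, v} E) ?r x =
      \<tau> x - laplacian V E (\<lambda>z. (f z)\<^sup>2) x / ?s - (if x = y then 2 else 0)"
    unfolding laplacian_insert[OF insert_facts] lap laplacian_f[OF x]
    using u_neq_v by (auto simp: diff_divide_distrib)
qed (rule finite_V V_nonempty)+

lemma sum_deg_insert:
  "(\<Sum>x\<in>V. deg V (insert {u, v} E) x * g x) = (\<Sum>x\<in>V. d x * g x) + g u + g v"
proof -
  have "(\<Sum>x\<in>V. deg V (insert {u, v} E) x * g x)
      = (\<Sum>x\<in>V. d x * g x + (if x = u then g x else 0) + (if x = v then g x else 0))"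
    by (rule sum.cong) (auto simp: deg_insert[OF insert_facts] algebra_simps)
  then show ?thesis
    using u v finite_V by (simp add: sum.distrib)
qed

lemma volume_insert: "ins.volume = volume + 2"
  using sum_deg_insert[of "\<lambda>_. 1"] by (simp add: ins.volume_def volume_def)

text \<open>The degree-weighted second moment of the potential, not a sum of squared differences
  over edges.\<close>

definition dirichlet :: real where
  "dirichlet = (\<Sum>x\<in>V. d x * (f x)\<^sup>2)"

text \<open>Expanding the square of \<open>f x - f y\<close> leaves only the moments of
  \<open>f\<close> of order 0, 1 and 2 under the new degrees. They are the old moments plus the
  contributions of the two endpoints.\<close>

lemma energy_insert:
  "ins.energy = energy + 2 * potential u + 2 * potential v + 2 * r u v
    - (2 * (volume + 2) * (dirichlet + (r u v)\<^sup>2 / 2) - (potential u - potential v)\<^sup>2 / 2) / (1 + r u v)"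
proof -
  let ?d' = "deg V (insert {u, v} E)"
  let ?s = "1 + r u v"
  have df: "(\<Sum>x\<in>V. d x * f x) = (potential u - potential v) / 2"
  proof -
    have "(\<Sum>x\<in>V. d x * f x) = (\<Sum>x\<in>V. d x * r u x - d x * r v x) / 2"
      unfolding sum_divide_distrib using r_commute u v
      by (intro sum.cong refl) (simp add: f_def algebra_simps)
    then show ?thesis
      by (simp add: potential_def sum_subtractf)
  qed
  have m0: "sum ?d' V = volume + 2"
    using volume_insert by (simp add: ins.volume_def)
  \<comment> \<open>The endpoint values of \<open>f\<close> are opposite, so the first moment does
    not change.\<close>
  have m1: "(\<Sum>x\<in>V. ?d' x * f x) = (potential u - potential v) / 2"
    unfolding sum_deg_insert df f_u f_v by simp
  have m2: "(\<Sum>x\<in>V. ?d' x * (f x)\<^sup>2) = dirichlet + (r u v)\<^sup>2 / 2"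
    unfolding sum_deg_insert f_u f_v dirichlet_def by (simp add: power2_eq_square)
  let ?G = "dirichlet + (r u v)\<^sup>2 / 2"
  have pot: "ins.potential x = potential x + r x u + r x v
      - ((volume + 2) * (f x)\<^sup>2 - (potential u - potential v) * f x + ?G) / ?s" for x
  proof -
    have "ins.potential x = (\<Sum>y\<in>V. ?d' y * r x y)
        - (\<Sum>y\<in>V. ?d' y * (f x)\<^sup>2 - 2 * f x * (?d' y * f y) + ?d' y * (f y)\<^sup>2) / ?s"
      unfolding ins.potential_def sum_divide_distrib sum_subtractf[symmetric]
      by (intro sum.cong refl) (simp add: power2_eq_square algebra_simps diff_divide_distrib add_divide_distrib)
    also have "(\<Sum>y\<in>V. ?d' y * (f x)\<^sup>2 - 2 * f x * (?d' y * f y) + ?d' y * (f y)\<^sup>2)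
        = (volume + 2) * (f x)\<^sup>2 - (potential u - potential v) * f x + ?G"
      unfolding sum.distrib sum_subtractf sum_distrib_left[symmetric] sum_distrib_right[symmetric] m0 m1 m2
      by simp
    also have "(\<Sum>y\<in>V. ?d' y * r x y) = potential x + r x u + r x v"
      unfolding sum_deg_insert potential_def by simp
    finally show ?thesis .
  qed
  have r1: "(\<Sum>x\<in>V. ?d' x * r x u) = potential u + r u v"
    unfolding sum_deg_insert potential_def using r_commute r_self u v by simp
  have r2: "(\<Sum>x\<in>V. ?d' x * r x v) = potential v + r u v"
    unfolding sum_deg_insert potential_def using r_commute r_self u v by simp
  have p: "(\<Sum>x\<in>V. ?d' x * potential x) = energy + potential u + potential v"
    unfolding sum_deg_insert energy_def by simp
  have "ins.energy = (\<Sum>x\<in>V. ?d' x * potential x) + (\<Sum>x\<in>V. ?d' x * r x u) + (\<Sum>x\<in>V. ?d' x * r x v)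
      - (\<Sum>x\<in>V. (volume + 2) * (?d' x * (f x)\<^sup>2) - (potential u - potential v) * (?d' x * f x)
          + ?d' x * ?G) / ?s"
    unfolding ins.energy_def pot sum_divide_distrib sum_subtractf[symmetric] sum.distrib[symmetric]
    by (intro sum.cong refl) (simp add: algebra_simps diff_divide_distrib add_divide_distrib)
  also have "(\<Sum>x\<in>V. (volume + 2) * (?d' x * (f x)\<^sup>2) - (potential u - potential v) * (?d' x * f x)
          + ?d' x * ?G) = 2 * (volume + 2) * ?G - (potential u - potential v)\<^sup>2 / 2"
    unfolding sum.distrib sum_subtractf sum_distrib_left[symmetric] sum_distrib_right[symmetric] m0 m1 m2
    by (simp add: power2_eq_square)
  finally show ?thesis
    unfolding r1 r2 p by simp
qed

text \<open>Clearing denominators gives \<open>energy * (volume + 2) < ins.energy * volume\<close>,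
  where \<open>energy * volume\<close> occurs on both sides and cancels.\<close>

lemma kemeny_insert_less_iff:
  "kemeny V E < kemeny V (insert {u, v} E) \<longleftrightarrow>
    2 * energy < volume * (2 * potential u + 2 * potential v + 2 * r u v
    - (2 * (volume + 2) * (dirichlet + (r u v)\<^sup>2 / 2) - (potential u - potential v)\<^sup>2 / 2) / (1 + r u v))"
proof -
  have "a / (2 * w) < b / (2 * (w + 2)) \<longleftrightarrow> a * (w + 2) < b * w" if "0 < w" for a b w :: real
  proof -
    have "a / (2 * w) < b / (2 * (w + 2)) \<longleftrightarrow> a / w < b / (w + 2)"
      by (metis divide_divide_eq_left' divide_less_cancel zero_less_numeral not_numeral_less_zero)
    then show ?thesis
      using that by (simp add: field_simps)
  qed
  then have "kemeny V E < kemeny V (insert {u, v} E) \<longleftrightarrow> energy * (volume + 2) < ins.energy * volume"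
    unfolding kemeny_eq ins.kemeny_eq volume_insert using volume_pos by blast
  then show ?thesis
    unfolding energy_insert by (simp add: algebra_simps)
qed

end

section \<open>The broom\<close>

text \<open>The graph distance: \<open>min x k\<close> moves a pendent vertex to the centre, and
  each pendent endpoint adds one step. Equal arguments are separate, since a pendent vertex would
  otherwise be at distance 2 from itself.\<close>

definition broom_dist :: "nat \<Rightarrow> nat \<Rightarrow> nat \<Rightarrow> real" where
  "broom_dist k x y = (if x = y then 0 else \<bar>real (min x k) - real (min y k)\<bar>
     + (if k < x then 1 else 0) + (if k < y then 1 else 0))"

locale broom =
  fixes k p :: nat
  assumes k: "2 \<le> k" and p: "1 \<le> p"
begin

abbreviation V :: "nat set" where "V \<equiv> broom_verts k p"
abbreviation E :: "nat set set" where "E \<equiv> broom_edges k p"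

lemma V_eq: "V = {1..k + p}"
  using k by (auto simp: broom_verts_def broom_path_def broom_star_def broom_pendents_def)

lemma mem_V: "x \<in> V \<longleftrightarrow> 1 \<le> x \<and> x \<le> k + p"
  by (simp add: V_eq)

lemma edge_iff:
  "{x, y} \<in> E \<longleftrightarrow> (1 \<le> x \<and> x < k \<and> y = x + 1) \<or> (1 \<le> y \<and> y < k \<and> x = y + 1)
     \<or> (x = k \<and> y \<in> {k + 1..k + p}) \<or> (y = k \<and> x \<in> {k + 1..k + p})"
  by (auto simp: broom_edges_def broom_pendents_def doubleton_eq_iff)

lemma sum_adj_broom:
  assumes "x \<in> V"
  shows "(\<Sum>y\<in>V. adj E x y * g y) = (if k < x then g k else (if 1 < x then g (x - 1) else 0)
    + (if x < k then g (x + 1) else (\<Sum>y=k+1..k+p. g y)))"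
proof -
  let ?L = "if 1 < x then {x - 1} else {}" and ?R = "if x < k then {x + 1} else {k + 1..k + p}"
  have "(\<Sum>y\<in>V. adj E x y * g y) = (\<Sum>y\<in>V. if {x, y} \<in> E then g y else 0)"
    by (rule sum.cong) (auto simp: adj_def)
  also have "\<dots> = (\<Sum>y\<in>{y\<in>V. {x, y} \<in> E}. g y)"
    by (rule sum.inter_filter[symmetric]) (simp add: V_eq)
  also have "{y\<in>V. {x, y} \<in> E} = (if k < x then {k} else ?L \<union> ?R)"
    using assms k p unfolding V_eq edge_iff by auto
  also have "sum g \<dots> = (if k < x then g k else sum g (?L \<union> ?R))"
    by simp
  also have "sum g (?L \<union> ?R) = sum g ?L + sum g ?R" if "x \<le> k"
    by (rule sum.union_disjoint) (use that in auto)
  then have "(if k < x then g k else sum g (?L \<union> ?R)) = (if k < x then g k else sum g ?L + sum g ?R)"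
    by simp
  finally show ?thesis
    by simp
qed

lemma deg_broom:
  assumes "x \<in> V"
  shows "deg V E x = (if k < x then 1 else (if 1 < x then 1 else 0) + (if x < k then 1 else real p))"
  using sum_adj_broom[OF assms, of "\<lambda>_. 1"] by (simp add: deg_eq_sum_adj V_eq)

lemma laplacian_broom:
  assumes "x \<in> V"
  shows "laplacian V E g x = (if k < x then g x - g k else (if 1 < x then g x - g (x - 1) else 0)
    + (if x < k then g x - g (x + 1) else (\<Sum>y=k+1..k+p. g x - g y)))"
  unfolding laplacian_def by (rule sum_adj_broom[OF assms])

text \<open>In a tree exactly one neighbour of \<open>x \<noteq> y\<close> is nearer to
  \<open>y\<close> by 1 and all others are farther by 1, which gives 1 minus the number of the
  others. At \<open>x = y\<close> every neighbour is farther.\<close>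

lemma laplacian_broom_dist:
  assumes x: "x \<in> V" and y: "y \<in> V"
  shows "laplacian V E (\<lambda>z. broom_dist k z y) x = 2 - deg V E x - (if x = y then 2 else 0)"
proof -
  consider "x < k" | "x = k" | "k < x" by linarith
  then show ?thesis
  proof cases
    case 1
    have "y = x \<or> real y + 1 \<le> real x \<or> real x + 1 \<le> real y"
      by linarith
    then show ?thesis
      unfolding laplacian_broom[OF x] deg_broom[OF x] using 1 x y
      by (auto simp: broom_dist_def mem_V min_def)
  next
    case 2
    have "(\<Sum>z=k+1..k+p. broom_dist k k y - broom_dist k z y)
        = (\<Sum>z=k+1..k+p. (if z = y then 2 else 0) - 1)"
      by (rule sum.cong) (use k in \<open>auto simp: broom_dist_def min_def\<close>)
    also have "\<dots> = - real p + (if k < y then 2 else 0)"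
      using y by (simp add: sum_subtractf mem_V)
    finally show ?thesis
      unfolding laplacian_broom[OF x] deg_broom[OF x] using 2 y k
      by (auto simp: broom_dist_def mem_V min_def)
  next
    case 3
    then show ?thesis
      unfolding laplacian_broom[OF x] deg_broom[OF x] using x y k
      by (auto simp: broom_dist_def mem_V min_def)
  qed
qed

sublocale resistance_network V E "broom_dist k" "\<lambda>x. 2 - deg V E x"
proof
  fix x assume x: "x \<in> V"
  have "0 < deg V E x"
    using k p by (simp add: deg_broom[OF x])
  then show "0 < vertex_degree V E x"
    by simp
qed (use k laplacian_broom_dist in \<open>auto simp: V_eq broom_dist_def\<close>)

text \<open>Regroups the degree sum by edges, each contributing its two endpoints. The sum over the
  path edges can then be telescoped.\<close>

lemma sum_deg_broom:
  "(\<Sum>x\<in>V. d x * g x) = (\<Sum>i=1..<k. g i + g (Suc i)) + real p * g k + (\<Sum>y=k+1..k+p. g y)"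
proof -
  have "V = {1..k} \<union> {k+1..k+p}"
    by (auto simp: V_eq)
  then have "(\<Sum>x\<in>V. d x * g x) = (\<Sum>x=1..k. d x * g x) + (\<Sum>x=k+1..k+p. d x * g x)"
    by (simp add: sum.union_disjoint)
  also have "(\<Sum>x=k+1..k+p. d x * g x) = (\<Sum>x=k+1..k+p. g x)"
    by (rule sum.cong) (auto simp: deg_broom mem_V)
  also have "(\<Sum>x=1..k. d x * g x) = (\<Sum>x=1..k. (if 1 < x then g x else 0) + (if x < k then g x else real p * g x))"
    by (rule sum.cong) (auto simp: deg_broom mem_V algebra_simps)
  also have "\<dots> = (\<Sum>x=1..k. if 1 < x then g x else 0) + (\<Sum>x=1..k. if x < k then g x else real p * g x)"
    by (rule sum.distrib)
  also have "(\<Sum>x=1..k. if 1 < x then g x else 0) = (\<Sum>x=Suc 1..<Suc k. g x)"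
    by (rule sum.mono_neutral_cong_right) auto
  also have "\<dots> = (\<Sum>i=1..<k. g (Suc i))"
    by (rule sum.shift_bounds_Suc_ivl)
  also have "(\<Sum>x=1..k. if x < k then g x else real p * g x) = (\<Sum>i=1..<k. g i) + real p * g k"
  proof -
    have "{1..k} = insert k {1..<k}"
      using k by auto
    then show ?thesis by simp
  qed
  finally show ?thesis
    by (simp add: sum.distrib)
qed

lemma volume_eq: "volume = 2 * (real k - 1 + real p)"
  using sum_deg_broom[of "\<lambda>_. 1"] k by (simp add: volume_def)

section \<open>Potentials and energy of the broom\<close>

lemma potential_path:
  assumes x: "x \<in> {1..k}"
  shows "potential x = (real x - 1)\<^sup>2 + (real k - real x)\<^sup>2 + 2 * real p * (real k - real x) + real p"
proof -
  \<comment> \<open>The signed square is a discrete antiderivative: no path edge has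
    \<open>x\<close> strictly inside, so both of its endpoints lie on the same side of
    \<open>x\<close>.\<close>
  let ?G = "\<lambda>i. (real i - real x) * \<bar>real i - real x\<bar>"
  have "(\<Sum>i=1..<k. broom_dist k x i + broom_dist k x (Suc i)) = (\<Sum>i=1..<k. ?G (Suc i) - ?G i)"
  proof (rule sum.cong)
    fix i assume "i \<in> {1..<k}"
    then have "broom_dist k x i = \<bar>real i - real x\<bar>" "broom_dist k x (Suc i) = \<bar>real (Suc i) - real x\<bar>"
      using x by (auto simp: broom_dist_def min_def)
    moreover have "real (Suc i) \<le> real x \<or> real x \<le> real i"
      by (simp only: of_nat_le_iff) linarith
    ultimately show "broom_dist k x i + broom_dist k x (Suc i) = ?G (Suc i) - ?G i"
      by (elim disjE) (simp_all add: abs_of_nonpos algebra_simps)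
  qed simp
  also have "\<dots> = ?G k - ?G 1"
    using k by (intro sum_Suc_diff') auto
  also have "\<dots> = (real x - 1)\<^sup>2 + (real k - real x)\<^sup>2"
    using x by (auto simp: abs_if power2_eq_square algebra_simps)
  finally have "(\<Sum>i=1..<k. broom_dist k x i + broom_dist k x (Suc i)) = (real x - 1)\<^sup>2 + (real k - real x)\<^sup>2" .
  moreover have "broom_dist k x k = real k - real x"
    using x by (auto simp: broom_dist_def)
  moreover have "(\<Sum>y=k+1..k+p. broom_dist k x y) = (\<Sum>y=k+1..k+p. real k - real x + 1)"
    by (rule sum.cong) (use x in \<open>auto simp: broom_dist_def min_def\<close>)
  ultimately show ?thesis
    unfolding potential_def sum_deg_broom by (simp only:) (simp add: algebra_simps)
qed

lemma potential_pendent: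
  assumes x: "x \<in> {k+1..k+p}"
  shows "potential x = (real k)\<^sup>2 + 3 * real p - 3"
proof -
  let ?G = "\<lambda>i. - (real k + 1 - real i)\<^sup>2"
  have "(\<Sum>i=1..<k. broom_dist k x i + broom_dist k x (Suc i)) = (\<Sum>i=1..<k. ?G (Suc i) - ?G i)"
  proof (rule sum.cong)
    fix i assume "i \<in> {1..<k}"
    then have "broom_dist k x i = real k + 1 - real i" "broom_dist k x (Suc i) = real k + 1 - real (Suc i)"
      using x by (auto simp: broom_dist_def min_def)
    then show "broom_dist k x i + broom_dist k x (Suc i) = ?G (Suc i) - ?G i"
      by (simp add: algebra_simps power2_eq_square)
  qed simp
  also have "\<dots> = ?G k - ?G 1"
    using k by (intro sum_Suc_diff') auto
  finally have "(\<Sum>i=1..<k. broom_dist k x i + broom_dist k x (Suc i)) = (real k)\<^sup>2 - 1"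
    by simp
  moreover have "broom_dist k x k = 1"
    using x by (auto simp: broom_dist_def)
  moreover have "(\<Sum>y=k+1..k+p. broom_dist k x y) = (\<Sum>y=k+1..k+p. 2 - (if y = x then 2 else 0))"
    by (rule sum.cong) (use x in \<open>auto simp: broom_dist_def min_def\<close>)
  moreover have "\<dots> = 2 * real p - 2"
    using x by (simp add: sum_subtractf)
  ultimately show ?thesis
    unfolding potential_def sum_deg_broom by simp
qed

lemma energy_eq:
  fixes a :: real defines "a \<equiv> real k - 1"
  shows "energy = (4 * a ^ 3 + 2 * a) / 3 + 4 * real p * a\<^sup>2 + 4 * real p * a + 4 * (real p)\<^sup>2 - 2 * real p"
proof -
  \<comment> \<open>A discrete antiderivative of \<open>potential i + potential (Suc i)\<close>; the
    cubic terms come from \<open>t^2 + (t + 1)^2\<close> being the increment of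
    \<open>(2 * t^3 + t) / 3\<close>.\<close>
  let ?H = "\<lambda>i. (2 * (real i - 1) ^ 3 + (real i - 1)) / 3 - (2 * (real k - real i) ^ 3 + (real k - real i)) / 3
    - 2 * real p * (real k - real i)\<^sup>2 + 2 * real p * real i"
  have "(\<Sum>i=1..<k. potential i + potential (Suc i)) = (\<Sum>i=1..<k. ?H (Suc i) - ?H i)"
    by (rule sum.cong)
      (simp_all add: potential_path power2_eq_square power3_eq_cube algebra_simps diff_divide_distrib add_divide_distrib)
  also have "\<dots> = ?H k - ?H 1"
    using k by (intro sum_Suc_diff') auto
  also have "\<dots> = (4 * a ^ 3 + 2 * a) / 3 + 2 * real p * a\<^sup>2 + 2 * real p * a"
    by (simp add: a_def diff_divide_distrib add_divide_distrib algebra_simps)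
  finally have "(\<Sum>i=1..<k. potential i + potential (Suc i)) = (4 * a ^ 3 + 2 * a) / 3 + 2 * real p * a\<^sup>2 + 2 * real p * a" .
  moreover have "potential k = a\<^sup>2 + real p"
    using k by (simp add: potential_path a_def)
  moreover have "(\<Sum>y=k+1..k+p. potential y) = real p * ((a + 1)\<^sup>2 + 3 * real p - 3)"
    by (simp add: potential_pendent a_def)
  ultimately show ?thesis
    unfolding energy_def sum_deg_broom by (simp add: power2_eq_square algebra_simps)
qed

end

section \<open>The sign of the change of Kemeny's constant\<close>

text \<open>
  In the two identities \<open>Du\<close>, \<open>Dv\<close> and \<open>F\<close> are the values of \<open>potential u\<close>, \<open>potential v\<close> and
  \<open>dirichlet\<close> for a chord \<open>{u, v}\<close> of the broom at distance \<open>l\<close>, and the cubic polynomial in \<open>a\<close> is its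
  \<open>energy\<close>.
\<close>

lemma path_chord_identity:
  fixes b l c p :: real
  assumes "l + 1 \<noteq> 0"
  defines "q \<equiv> c + p" and "w \<equiv> b + c + p" and "m \<equiv> b + l + c + p" and "a \<equiv> b + l + c"
  defines "Du \<equiv> b\<^sup>2 + (l + c)\<^sup>2 + 2 * p * (l + c) + p" and "Dv \<equiv> (b + l)\<^sup>2 + c\<^sup>2 + 2 * p * c + p"
    and "F \<equiv> (b + c + p) * l\<^sup>2 / 2 + l * (l\<^sup>2 + 2) / 6"
  shows "m * (2 * Du + 2 * Dv + 2 * l - (4 * (m + 1) * (F + l\<^sup>2 / 2) - (Du - Dv)\<^sup>2 / 2) / (1 + l))
    - ((4 * a ^ 3 + 2 * a) / 3 + 4 * p * a\<^sup>2 + 4 * p * a + 4 * p\<^sup>2 - 2 * p)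
    = 8 / 3 * (m * (w\<^sup>2 - w * l\<^sup>2 - 3 * b * q * (l\<^sup>2 + l + 1) / (l + 1) - (l - 1)\<^sup>2 * (l + 1) / 4) - (p ^ 3 - p))"
proof -
  \<comment> \<open>With \<open>s * (1 + l) = 1\<close> as the only relation on \<open>s\<close>,
    the claim is polynomial and within reach of \<open>algebra\<close>.\<close>
  define s where "s = inverse (1 + l)"
  have s: "s * (1 + l) = 1"
    using assms(1) by (simp add: s_def add.commute)
  show ?thesis
    unfolding divide_inverse add.commute[of l 1] s_def[symmetric] q_def w_def m_def a_def Du_def Dv_def F_def
    using s by simp algebra
qed

lemma path_pendent_identity:
  fixes b l P :: real
  assumes "l + 1 \<noteq> 0"
  defines "p \<equiv> P + 1" and "m \<equiv> b + l + P" and "a \<equiv> b + l - 1"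
  defines "Du \<equiv> b\<^sup>2 + (l - 1)\<^sup>2 + 2 * p * (l - 1) + p" and "Dv \<equiv> (b + l)\<^sup>2 + 3 * P"
    and "F \<equiv> b * l\<^sup>2 / 2 + l * (l\<^sup>2 + 2) / 6 + P * (l - 2)\<^sup>2 / 2"
  shows "m * (2 * Du + 2 * Dv + 2 * l - (4 * (m + 1) * (F + l\<^sup>2 / 2) - (Du - Dv)\<^sup>2 / 2) / (1 + l))
    - ((4 * a ^ 3 + 2 * a) / 3 + 4 * p * a\<^sup>2 + 4 * p * a + 4 * p\<^sup>2 - 2 * p)
    = 8 / 3 * (m * (b\<^sup>2 - b * l\<^sup>2 - (l - 1)\<^sup>2 * (l + 1) / 4 + P * (4 * l - l\<^sup>2 - 3 * b * (l - 1)\<^sup>2 / (l + 1)))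
        - P * ((b + l)\<^sup>2 + 3 * P + 2))"
proof -
  define s where "s = inverse (1 + l)"
  have s: "s * (1 + l) = 1"
    using assms(1) by (simp add: s_def add.commute)
  show ?thesis
    unfolding divide_inverse add.commute[of l 1] s_def[symmetric] p_def m_def a_def Du_def Dv_def F_def
    using s by simp algebra
qed

section \<open>Explicit Braess criteria for the three kinds of chords\<close>

context broom
begin

lemma insert_network:
  assumes "u \<in> V" "v \<in> V" "u \<noteq> v" "{u, v} \<notin> E"
  shows "resistance_network_insert V E (broom_dist k) (\<lambda>x. 2 - deg V E x) u v"
  by unfold_locales (use assms in \<open>auto simp: broom_dist_def\<close>)

text \<open>The broom has \<open>m\<close> edges, so \<open>volume = 2 * m\<close> and a factor 2
  cancels. The second moment \<open>F\<close> of the potential \<open>g\<close> is to be supplied in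
  the edgewise form of \<open>sum_deg_broom\<close>.\<close>

lemma kemeny_insert_iff:
  fixes m :: real
  assumes uv: "u \<in> V" "v \<in> V" "u \<noteq> v" "{u, v} \<notin> E"
    and F: "(\<Sum>i=1..<k. (g i)\<^sup>2 + (g (Suc i))\<^sup>2) + real p * (g k)\<^sup>2 + (\<Sum>y=k+1..k+p. (g y)\<^sup>2) = F"
    and g: "\<And>x. x \<in> V \<Longrightarrow> g x = (broom_dist k x u - broom_dist k x v) / 2"
  defines "m \<equiv> real k - 1 + real p"
  shows "kemeny V E < kemeny V (insert {u, v} E) \<longleftrightarrow>
    energy < m * (2 * potential u + 2 * potential v + 2 * broom_dist k u v
    - (4 * (m + 1) * (F + (broom_dist k u v)\<^sup>2 / 2) - (potential u - potential v)\<^sup>2 / 2) / (1 + broom_dist k u v))"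
proof -
  interpret I: resistance_network_insert V E "broom_dist k" "\<lambda>x. 2 - deg V E x" u v
    by (rule insert_network[OF uv])
  have "I.dirichlet = (\<Sum>x\<in>V. d x * (g x)\<^sup>2)"
    unfolding I.dirichlet_def by (intro sum.cong refl) (simp add: I.f_def g)
  then have "I.dirichlet = F"
    using F by (simp only: sum_deg_broom)
  moreover have "volume = 2 * m" "2 * (volume + 2) = 4 * (m + 1)"
    by (simp_all add: volume_eq m_def)
  ultimately show ?thesis
    unfolding I.kemeny_insert_less_iff by (simp only: mult.assoc) simp
qed

text \<open>The current between two pendent vertices passes only through the centre, so its
  potential is 1 and -1 at the two ends and 0 elsewhere, with second moment 2.\<close>

lemma pendents_braess:
  assumes u: "u \<in> {k+1..k+p}" and v: "v \<in> {k+1..k+p}" and uv: "u \<noteq> v" and k3: "3 \<le> k"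
  shows "kemeny V E < kemeny V (insert {u, v} E)"
proof -
  define g :: "nat \<Rightarrow> real" where "g x = (if x = v then 1 else 0) - (if x = u then 1 else 0)" for x
  define a where "a = real k - 1"
  have "(\<Sum>i=1..<k. (g i)\<^sup>2 + (g (Suc i))\<^sup>2) = 0"
    by (rule sum.neutral) (use u v in \<open>auto simp: g_def\<close>)
  moreover have "g k = 0"
    using u v by (auto simp: g_def)
  moreover have "(\<Sum>y=k+1..k+p. (g y)\<^sup>2) = (\<Sum>y=k+1..k+p. (if y = v then 1 else 0) + (if y = u then 1 else 0))"
    by (rule sum.cong) (use uv in \<open>auto simp: g_def\<close>)
  moreover have "\<dots> = 2"
    using u v by (simp add: sum.distrib)
  ultimately have F: "(\<Sum>i=1..<k. (g i)\<^sup>2 + (g (Suc i))\<^sup>2) + real p * (g k)\<^sup>2 + (\<Sum>y=k+1..k+p. (g y)\<^sup>2) = 2"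
    by simp
  have g: "g x = (broom_dist k x u - broom_dist k x v) / 2" for x
    using u v uv by (auto simp: g_def broom_dist_def)
  have dist: "broom_dist k u v = 2"
    using u v uv by (auto simp: broom_dist_def)
  have V: "u \<in> V" "v \<in> V"
    using u v by (auto simp: mem_V)
  have "{u, v} \<notin> E"
    using u v uv by (auto simp: edge_iff)
  note iff = kemeny_insert_iff[OF V uv this F g]
  have p2: "2 \<le> p"
    using u v uv by auto
  have a2: "2 \<le> a" "2 \<le> real p"
    using k3 p2 by (auto simp: a_def)
  have pot: "potential u = a\<^sup>2 + 2 * a + 3 * real p - 2" "potential v = a\<^sup>2 + 2 * a + 3 * real p - 2"
    using u v by (simp_all add: potential_pendent a_def power2_eq_square algebra_simps)
  have "0 \<le> 8 * (a * (a\<^sup>2 - 4))" "0 \<le> 16 * (real p * (a - 2))"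
    using a2 power_mono[of 2 a 2] by auto
  \<comment> \<open>The excess of the right side of the criterion over the left, grouped so that no
    term is negative for \<open>a \<ge> 2\<close>.\<close>
  then have "0 < (8 * (a * (a\<^sup>2 - 4)) + 16 * (real p * (a - 2)) + 2 * a + 10 * real p + 8 * a\<^sup>2 + 8 * (real p)\<^sup>2) / 3"
    using a2 by (intro divide_pos_pos add_nonneg_pos) auto
  then show ?thesis
    unfolding iff pot dist energy_eq a_def[symmetric]
    by (simp add: field_simps power2_eq_square power3_eq_cube)
qed

lemma sum_consecutive_squares:
  assumes "m \<le> n"
  shows "(\<Sum>i=m..<n. (real i - x)\<^sup>2 + (real (Suc i) - x)\<^sup>2)
    = (2 * (real n - x) ^ 3 + (real n - x)) / 3 - (2 * (real m - x) ^ 3 + (real m - x)) / 3"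
proof -
  have "(\<Sum>i=m..<n. (real i - x)\<^sup>2 + (real (Suc i) - x)\<^sup>2) = (\<Sum>i=m..<n.
      (2 * (real (Suc i) - x) ^ 3 + (real (Suc i) - x)) / 3 - (2 * (real i - x) ^ 3 + (real i - x)) / 3)"
    by (rule sum.cong)
      (simp_all add: power2_eq_square power3_eq_cube algebra_simps diff_divide_distrib add_divide_distrib)
  also have "\<dots> = (2 * (real n - x) ^ 3 + (real n - x)) / 3 - (2 * (real m - x) ^ 3 + (real m - x)) / 3"
    using assms by (rule sum_Suc_diff')
  finally show ?thesis .
qed

text \<open>On a path the potential of the current between \<open>u\<close> and \<open>v\<close> is
  constant outside and has slope 1 in between. Each outer edge gives \<open>l\<^sup>2 / 2\<close>;
  the inner ones are summed about the midpoint.\<close>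

lemma sum_clamped_squares:
  fixes u v :: nat and g :: "nat \<Rightarrow> real"
  defines "l \<equiv> real v - real u"
  assumes "1 \<le> u" "u \<le> v" "v \<le> n"
    and g1: "\<And>i. i \<le> u \<Longrightarrow> g i = - (l / 2)"
    and g2: "\<And>i. u \<le> i \<Longrightarrow> i \<le> v \<Longrightarrow> g i = real i - (real u + real v) / 2"
    and g3: "\<And>i. v \<le> i \<Longrightarrow> i \<le> n \<Longrightarrow> g i = l / 2"
  shows "(\<Sum>i=1..<n. (g i)\<^sup>2 + (g (Suc i))\<^sup>2)
    = (real u - 1 + (real n - real v)) * l\<^sup>2 / 2 + l * (l\<^sup>2 + 2) / 6"
proof -
  let ?s = "\<lambda>A. \<Sum>i\<in>A. (g i)\<^sup>2 + (g (Suc i))\<^sup>2"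
  have "?s {1..<n} = ?s {1..<u} + ?s {u..<v} + ?s {v..<n}"
    using \<open>1 \<le> u\<close> \<open>u \<le> v\<close> \<open>v \<le> n\<close> by (simp add: sum.atLeastLessThan_concat)
  moreover have "?s {1..<u} = (\<Sum>i=1..<u. l\<^sup>2 / 2)"
    by (rule sum.cong) (simp_all add: g1 power2_eq_square)
  moreover have "?s {v..<n} = (\<Sum>i=v..<n. l\<^sup>2 / 2)"
    by (rule sum.cong) (simp_all add: g3 power2_eq_square)
  moreover have "?s {u..<v} = (\<Sum>i=u..<v. (real i - (real u + real v) / 2)\<^sup>2 + (real (Suc i) - (real u + real v) / 2)\<^sup>2)"
    by (rule sum.cong) (simp_all add: g2)
  moreover have "\<dots> = l * (l\<^sup>2 + 2) / 6"
    unfolding sum_consecutive_squares[OF \<open>u \<le> v\<close>] l_def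
    by (simp add: field_simps power2_eq_square power3_eq_cube)
  ultimately show ?thesis
    using \<open>1 \<le> u\<close> \<open>v \<le> n\<close> by (simp add: of_nat_diff field_simps)
qed

lemma pos_scaled_diff_iff:
  fixes m R T :: real
  assumes "0 < m"
  shows "0 < 8 / 3 * (m * T - R) \<longleftrightarrow> R / m < T"
  using assms by (auto simp: field_simps)

text \<open>Of the \<open>m\<close> edges the chord puts \<open>l\<close> on a cycle, leaving
  \<open>b\<close> on the left and \<open>q\<close>, including the pendent ones, on the right;
  \<open>w = b + q\<close>. The only gain is the square of \<open>w\<close>, all other terms are
  costs.\<close>

lemma path_braess_iff:
  fixes u v :: nat and b l c q w m :: real
  assumes u: "1 \<le> u" and uv: "u + 2 \<le> v" and v: "v \<le> k"
  defines "b \<equiv> real u - 1" and "l \<equiv> real v - real u" and "c \<equiv> real k - real v"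
  defines "q \<equiv> c + real p" and "w \<equiv> b + c + real p" and "m \<equiv> real k - 1 + real p"
  shows "kemeny V E < kemeny V (insert {u, v} E) \<longleftrightarrow>
    w * l\<^sup>2 + 3 * b * q * (l\<^sup>2 + l + 1) / (l + 1) + (l - 1)\<^sup>2 * (l + 1) / 4 + (real p ^ 3 - real p) / m < w\<^sup>2"
proof -
  define g where "g x = (broom_dist k x u - broom_dist k x v) / 2" for x
  have "(\<Sum>i=1..<k. (g i)\<^sup>2 + (g (Suc i))\<^sup>2)
      = (real u - 1 + (real k - real v)) * (real v - real u)\<^sup>2 / 2 + (real v - real u) * ((real v - real u)\<^sup>2 + 2) / 6"
    by (rule sum_clamped_squares) (use u uv v in \<open>auto simp: g_def broom_dist_def min_def field_simps\<close>)
  moreover have "g k = l / 2"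
    using u uv v by (auto simp: g_def broom_dist_def l_def field_simps)
  moreover have "(\<Sum>y=k+1..k+p. (g y)\<^sup>2) = (\<Sum>y=k+1..k+p. (l / 2)\<^sup>2)"
    by (rule sum.cong) (use u uv v in \<open>auto simp: g_def broom_dist_def min_def l_def field_simps\<close>)
  ultimately have F: "(\<Sum>i=1..<k. (g i)\<^sup>2 + (g (Suc i))\<^sup>2) + real p * (g k)\<^sup>2 + (\<Sum>y=k+1..k+p. (g y)\<^sup>2)
      = (b + c + real p) * l\<^sup>2 / 2 + l * (l\<^sup>2 + 2) / 6"
    by (simp only: l_def[symmetric]) (simp add: b_def c_def power2_eq_square field_simps)
  have V: "u \<in> V" "v \<in> V" "u \<noteq> v" "{u, v} \<notin> E"
    using u uv v by (auto simp: mem_V edge_iff)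
  have dist: "broom_dist k u v = l"
    using uv v by (auto simp: broom_dist_def l_def)
  have pot: "potential u = b\<^sup>2 + (l + c)\<^sup>2 + 2 * real p * (l + c) + real p" "potential v = (b + l)\<^sup>2 + c\<^sup>2 + 2 * real p * c + real p"
    using u uv v by (auto simp: potential_path b_def c_def l_def)
  have m: "m = b + l + c + real p" and a: "real k - 1 = b + l + c"
    by (auto simp: m_def b_def c_def l_def)
  have l: "l + 1 \<noteq> 0" and mpos: "0 < m"
    using uv k p by (auto simp: l_def m_def)
  have "kemeny V E < kemeny V (insert {u, v} E) \<longleftrightarrow>
    0 < 8 / 3 * (m * (w\<^sup>2 - w * l\<^sup>2 - 3 * b * q * (l\<^sup>2 + l + 1) / (l + 1) - (l - 1)\<^sup>2 * (l + 1) / 4) - (real p ^ 3 - real p))"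
    unfolding kemeny_insert_iff[OF V F g_def] dist pot energy_eq a m q_def w_def path_chord_identity[OF l, symmetric]
    by simp
  also have "\<dots> \<longleftrightarrow> (real p ^ 3 - real p) / m < w\<^sup>2 - w * l\<^sup>2 - 3 * b * q * (l\<^sup>2 + l + 1) / (l + 1) - (l - 1)\<^sup>2 * (l + 1) / 4"
    using mpos by (rule pos_scaled_diff_iff)
  also have "\<dots> \<longleftrightarrow> w * l\<^sup>2 + 3 * b * q * (l\<^sup>2 + l + 1) / (l + 1) + (l - 1)\<^sup>2 * (l + 1) / 4 + (real p ^ 3 - real p) / m < w\<^sup>2"
    by linarith
  finally show ?thesis .
qed

text \<open>Here \<open>l\<close> is the distance from \<open>u\<close> to \<open>v\<close>, and
  \<open>P\<close> counts the pendent vertices other than \<open>v\<close>.\<close>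

lemma path_pendent_braess_iff:
  fixes u v :: nat and b l P m :: real
  assumes u: "1 \<le> u" "u < k" and v: "v \<in> {k+1..k+p}"
  defines "b \<equiv> real u - 1" and "l \<equiv> real k + 1 - real u" and "P \<equiv> real p - 1" and "m \<equiv> real k - 1 + real p"
  shows "kemeny V E < kemeny V (insert {u, v} E) \<longleftrightarrow>
    P * ((real k)\<^sup>2 + 3 * P + 2) / m
      < b\<^sup>2 - b * l\<^sup>2 - (l - 1)\<^sup>2 * (l + 1) / 4 + P * (4 * l - l\<^sup>2 - 3 * b * (l - 1)\<^sup>2 / (l + 1))"
proof -
  define g where "g x = (broom_dist k x u - broom_dist k x v) / 2" for x
  have g1: "g x = - (l / 2)" if "x \<le> u" for x
    using that u v by (auto simp: g_def broom_dist_def min_def l_def field_simps)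
  have g2: "g x = real x - real u - l / 2" if "u \<le> x" "x \<le> k" for x
    using that u v by (auto simp: g_def broom_dist_def min_def l_def field_simps)
  have g3: "g y = (if y = v then l / 2 else l / 2 - 1)" if "k < y" for y
    using that u v by (auto simp: g_def broom_dist_def min_def l_def field_simps)
  have gk: "g k = l / 2 - 1"
    using u by (simp add: g2 l_def field_simps)
  have l': "real (Suc k) - real u = l"
    by (simp add: l_def)
  \<comment> \<open>The path followed by \<open>v\<close> is a path with \<open>k + 1\<close>
    vertices; \<open>h\<close> is \<open>g\<close> with \<open>v\<close> placed at position
    \<open>k + 1\<close>. The contribution of the additional edge is split off afterwards.\<close>
  define h where "h i = (if i \<le> k then g i else l / 2)" for i
  have "(\<Sum>i=1..<Suc k. (h i)\<^sup>2 + (h (Suc i))\<^sup>2)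
      = (real u - 1 + (real (Suc k) - real (Suc k))) * (real (Suc k) - real u)\<^sup>2 / 2
        + (real (Suc k) - real u) * ((real (Suc k) - real u)\<^sup>2 + 2) / 6"
    by (rule sum_clamped_squares)
      (use u in \<open>auto simp: h_def g1 g2 l_def field_simps le_Suc_eq\<close>)
  also have "(\<Sum>i=1..<Suc k. (h i)\<^sup>2 + (h (Suc i))\<^sup>2) = (\<Sum>i=1..<k. (g i)\<^sup>2 + (g (Suc i))\<^sup>2) + (g k)\<^sup>2 + l\<^sup>2 / 4"
    using k by (simp add: h_def power2_eq_square)
  finally have A: "(\<Sum>i=1..<k. (g i)\<^sup>2 + (g (Suc i))\<^sup>2) = b * l\<^sup>2 / 2 + l * (l\<^sup>2 + 2) / 6 - (l / 2 - 1)\<^sup>2 - l\<^sup>2 / 4"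
    unfolding l' gk by (simp add: b_def)
  have B: "(\<Sum>y=k+1..k+p. (g y)\<^sup>2) = l\<^sup>2 / 4 + P * (l / 2 - 1)\<^sup>2"
  proof -
    have "(\<Sum>y=k+1..k+p. (g y)\<^sup>2) = (\<Sum>y=k+1..k+p. (l / 2 - 1)\<^sup>2 + (if y = v then l\<^sup>2 / 4 - (l / 2 - 1)\<^sup>2 else 0))"
      by (rule sum.cong) (auto simp: g3 power2_eq_square)
    then show ?thesis
      using v by (simp add: sum.distrib P_def algebra_simps)
  qed
  have F: "(\<Sum>i=1..<k. (g i)\<^sup>2 + (g (Suc i))\<^sup>2) + real p * (g k)\<^sup>2 + (\<Sum>y=k+1..k+p. (g y)\<^sup>2)
      = b * l\<^sup>2 / 2 + l * (l\<^sup>2 + 2) / 6 + P * (l - 2)\<^sup>2 / 2"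
    unfolding A B gk by (simp add: P_def power2_eq_square field_simps)
  have V: "u \<in> V" "v \<in> V" "u \<noteq> v" "{u, v} \<notin> E"
    using u v by (auto simp: mem_V edge_iff)
  have dist: "broom_dist k u v = l"
    using u v by (auto simp: broom_dist_def l_def)
  have pot: "potential u = b\<^sup>2 + (l - 1)\<^sup>2 + 2 * (P + 1) * (l - 1) + (P + 1)" "potential v = (b + l)\<^sup>2 + 3 * P"
    using u v by (auto simp: potential_path potential_pendent b_def P_def l_def)
  have m: "m = b + l + P" and a: "real k - 1 = b + l - 1" and k': "real k = b + l" and p': "real p = P + 1"
    by (auto simp: m_def b_def P_def l_def)
  have l: "l + 1 \<noteq> 0" and mpos: "0 < m"
    using u k p by (auto simp: l_def m_def)
  let ?T = "b\<^sup>2 - b * l\<^sup>2 - (l - 1)\<^sup>2 * (l + 1) / 4 + P * (4 * l - l\<^sup>2 - 3 * b * (l - 1)\<^sup>2 / (l + 1))"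
  have m': "real k - 1 + real p = b + l + P"
    using m by (simp add: m_def)
  have "kemeny V E < kemeny V (insert {u, v} E) \<longleftrightarrow>
    0 < 8 / 3 * (m * ?T - P * ((b + l)\<^sup>2 + 3 * P + 2))"
    unfolding kemeny_insert_iff[OF V F g_def] dist pot energy_eq m' unfolding m a p' path_pendent_identity[OF l, symmetric]
    by simp
  also have "\<dots> \<longleftrightarrow> P * ((real k)\<^sup>2 + 3 * P + 2) / m < ?T"
    unfolding k' using mpos by (rule pos_scaled_diff_iff)
  finally show ?thesis .
qed

end

section \<open>Inequalities for Braess chords\<close>

text \<open>After multiplication by \<open>m\<close>, the gain minus the cubic cost is essentially
  at most \<open>m ^ 3 - p ^ 3\<close>, a multiple of \<open>m - p = a\<close>. So
  \<open>b * q * l\<close> is of order at most \<open>a * m\<close>, and since \<open>b\<close> or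
  \<open>q\<close> is at least \<open>m / 3\<close>, dividing by it bounds the other one times
  \<open>l\<close>.\<close>

lemma path_chord_necessary:
  fixes b l c p :: real
  assumes nonneg: "0 \<le> b" "0 \<le> c" and l: "2 \<le> l" and p: "1 \<le> p"
  defines "q \<equiv> c + p" and "w \<equiv> b + c + p" and "m \<equiv> b + l + c + p" and "a \<equiv> b + l + c"
  assumes less: "w * l\<^sup>2 + 3 * b * q * (l\<^sup>2 + l + 1) / (l + 1) + (l - 1)\<^sup>2 * (l + 1) / 4 + (p ^ 3 - p) / m < w\<^sup>2"
  shows "b * l \<le> 3 * a + 1 \<or> c * l \<le> 3 * a + 1"
proof -
  have pos: "0 < w" "0 < m" "1 \<le> m" "0 < q" "0 < a"
    using nonneg l p by (auto simp: w_def m_def q_def a_def)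
  have "p \<le> p ^ 3"
    using p power_increasing[of 1 3 p] by simp
  then have p3: "0 \<le> (p ^ 3 - p) / m"
    using pos by simp
  have sq: "0 \<le> (l - 1)\<^sup>2 * (l + 1) / 4"
    using l by simp
  have frac: "3 * (b * q * l) \<le> 3 * b * q * (l\<^sup>2 + l + 1) / (l + 1)"
  proof -
    have "l \<le> (l\<^sup>2 + l + 1) / (l + 1)"
      using l by (simp add: field_simps power2_eq_square)
    then have "3 * b * q * l \<le> 3 * b * q * ((l\<^sup>2 + l + 1) / (l + 1))"
      using nonneg pos by (intro mult_left_mono) auto
    then show ?thesis by (simp add: mult.assoc)
  qed
  have bql: "0 \<le> b * q * l"
    using nonneg pos l by simp
  have "w * l\<^sup>2 < w\<^sup>2"
    using less p3 sq frac bql by linarith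
  then have "l\<^sup>2 < w"
    using pos by (simp add: power2_eq_square[of w])
  moreover have "2 * l \<le> l\<^sup>2"
    using l by (simp add: power2_eq_square)
  \<comment> \<open>From \<open>2 * l \<le> l\<^sup>2 < w\<close> and
    \<open>m = w + l\<close>.\<close>
  ultimately have mw: "2 * m \<le> 3 * w"
    by (simp add: m_def w_def)
  have "m * (3 * (b * q * l)) \<le> m * (w\<^sup>2 - (p ^ 3 - p) / m)"
  proof (rule mult_left_mono)
    have "0 \<le> w * l\<^sup>2"
      using pos by simp
    then show "3 * (b * q * l) \<le> w\<^sup>2 - (p ^ 3 - p) / m"
      using less sq frac by linarith
  qed (use pos in simp)
  also have "\<dots> = m * w\<^sup>2 - p ^ 3 + p"
    using pos by (simp add: field_simps)
  also have "\<dots> \<le> m * m\<^sup>2 - p ^ 3 + p"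
    using pos l by (intro add_right_mono diff_right_mono mult_left_mono power_mono) (auto simp: w_def m_def)
  \<comment> \<open>The factor \<open>a = m - p\<close> of the difference of cubes makes the bound
    uniform in \<open>p\<close>.\<close>
  also have "\<dots> = a * (m\<^sup>2 + m * p + p\<^sup>2) + p"
    by (simp add: m_def a_def power2_eq_square power3_eq_cube algebra_simps)
  also have "\<dots> \<le> a * (m\<^sup>2 + m * m + m\<^sup>2) + m"
    using pos nonneg l p by (intro add_mono mult_left_mono power_mono) (auto simp: m_def)
  also have "\<dots> = m * (3 * a * m + 1)"
    by (simp add: power2_eq_square algebra_simps)
  finally have bound: "3 * (b * q * l) \<le> 3 * a * m + 1"
    using pos by simp
  have large: "x * l \<le> 3 * a + 1" if "m \<le> 3 * y" "0 \<le> x" "x * y * l = b * q * l" for x y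
  proof -
    have "m * (x * l) \<le> 3 * y * (x * l)"
      using that l by (intro mult_right_mono) auto
    also have "\<dots> = 3 * (b * q * l)"
      using that(3) by (simp add: mult_ac)
    also have "\<dots> \<le> m * (3 * a + 1)"
      using bound pos by (simp add: algebra_simps)
    finally show ?thesis
      using pos by simp
  qed
  show ?thesis
  proof (cases "b \<le> q")
    case True
    then have "m \<le> 3 * q"
      using mw by (simp add: w_def q_def)
    then show ?thesis
      using large[of q b] nonneg by simp
  next
    case False
    then have "m \<le> 3 * b"
      using mw by (simp add: w_def q_def)
    then have "q * l \<le> 3 * a + 1"
      using large[of b q] pos by simp
    moreover have "c * l \<le> q * l"
      using l p by (intro mult_right_mono) (auto simp: q_def)
    ultimately show ?thesis by linarith
  qed
qed

text \<open>The gain is at least \<open>m * a + p\<^sup>2 - m * l\<^sup>2\<close>. The costs are at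
  most \<open>m * l\<^sup>2\<close>, \<open>m * a / 2\<close> (this uses the 9),
  \<open>m * l\<^sup>2 / 4\<close> and \<open>p\<^sup>2\<close>. It remains to have
  \<open>9 / 4 * l\<^sup>2 < a / 2\<close>, which the 5 guarantees.\<close>

lemma path_chord_sufficient:
  fixes b l c p :: real
  assumes nonneg: "0 \<le> b" "0 \<le> c" and l: "2 \<le> l" and p: "1 \<le> p"
  defines "q \<equiv> c + p" and "w \<equiv> b + c + p" and "m \<equiv> b + l + c + p" and "a \<equiv> b + l + c"
  assumes la: "5 * l\<^sup>2 \<le> a" and ba: "9 * b * l \<le> a"
  shows "w * l\<^sup>2 + 3 * b * q * (l\<^sup>2 + l + 1) / (l + 1) + (l - 1)\<^sup>2 * (l + 1) / 4 + (p ^ 3 - p) / m < w\<^sup>2"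
proof -
  have pos: "0 < w" "0 < m" "0 < q" "0 < a" "q \<le> m" "w \<le> m" "p \<le> m" "l \<le> m"
    using nonneg l p by (auto simp: w_def m_def q_def a_def)
  have 1: "w * l\<^sup>2 \<le> m * l\<^sup>2"
    using pos by (intro mult_right_mono) auto
  have 2: "3 * b * q * (l\<^sup>2 + l + 1) / (l + 1) \<le> m * a / 2"
  proof -
    have "(l\<^sup>2 + l + 1) / (l + 1) \<le> 3 / 2 * l"
      using l by (simp add: field_simps power2_eq_square) (use mult_mono[of 2 l 2 l] in linarith)
    then have "3 * b * q * ((l\<^sup>2 + l + 1) / (l + 1)) \<le> 3 * b * m * (3 / 2 * l)"
      using nonneg pos l by (intro mult_mono) auto
    also have "\<dots> = m * (9 * b * l) / 2"
      by simp
    also have "\<dots> \<le> m * a / 2"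
      using ba pos by simp
    finally show ?thesis by simp
  qed
  have 3: "(l - 1)\<^sup>2 * (l + 1) / 4 \<le> m * l\<^sup>2 / 4"
  proof -
    have "(l - 1)\<^sup>2 * (l + 1) \<le> l * l\<^sup>2"
      using l by (simp add: power2_eq_square algebra_simps) (use zero_le_square[of l] in linarith)
    also have "\<dots> \<le> m * l\<^sup>2"
      using pos by (intro mult_right_mono) auto
    finally show ?thesis by simp
  qed
  have 4: "(p ^ 3 - p) / m \<le> p\<^sup>2"
  proof -
    have "p ^ 3 - p \<le> p\<^sup>2 * m"
    proof -
      have "p\<^sup>2 * p \<le> p\<^sup>2 * m"
        using pos by (intro mult_left_mono) auto
      moreover have "p ^ 3 = p\<^sup>2 * p"
        by (simp add: power2_eq_square power3_eq_cube)
      ultimately show ?thesis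
        using p by linarith
    qed
    then show ?thesis
      using pos by (simp add: pos_divide_le_eq)
  qed
  have 5: "m * a + p\<^sup>2 - m * l\<^sup>2 \<le> w\<^sup>2"
  proof -
    have "w\<^sup>2 = m * a + p\<^sup>2 - m * (2 * l) + l\<^sup>2 + p * a"
      by (simp add: w_def m_def a_def power2_eq_square algebra_simps)
    moreover have "m * (2 * l) \<le> m * l\<^sup>2"
      using pos l by (intro mult_left_mono) (auto simp: power2_eq_square)
    moreover have "0 \<le> p * a"
      using p pos by simp
    ultimately show ?thesis
      using zero_le_power2[of l] by linarith
  qed
  have "m * (5 * l\<^sup>2) \<le> m * a" "0 < m * a"
    using la pos by (auto intro: mult_left_mono)
  then show ?thesis
    using 1 2 3 4 5 by linarith
qed

text \<open>The cost contains at least \<open>P * b * l / 2\<close>, while the gain is the square of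
  \<open>b\<close> plus \<open>P * l * (4 - l)\<close>, which is positive only for
  \<open>l < 4\<close>. Cancelling \<open>b\<close> gives the bound.\<close>

lemma path_pendent_necessary:
  fixes b l P R :: real
  assumes b: "0 \<le> b" and l: "2 \<le> l" and P: "1 \<le> P" and large: "12 \<le> b + l" and R: "0 \<le> R"
  assumes less: "R < b\<^sup>2 - b * l\<^sup>2 - (l - 1)\<^sup>2 * (l + 1) / 4 + P * (4 * l - l\<^sup>2 - 3 * b * (l - 1)\<^sup>2 / (l + 1))"
  shows "P * l < 4 * b"
proof -
  have "l / 6 \<le> (l - 1)\<^sup>2 / (l + 1)"
  proof -
    \<comment> \<open>The difference of the two sides is
      \<open>(l - 2) * (5 * l - 3)\<close>.\<close>
    have "l * (l + 1) \<le> 6 * (l - 1)\<^sup>2"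
      using l mult_mono[of 2 l 0 "l - 2"] mult_nonneg_nonneg[of "l - 2" "5 * l - 3"]
      by (simp add: power2_eq_square algebra_simps)
    then show ?thesis
      using l by (simp add: field_simps)
  qed
  then have "P * (3 * b) * (l / 6) \<le> P * (3 * b) * ((l - 1)\<^sup>2 / (l + 1))"
    using b P by (intro mult_left_mono) auto
  then have frac: "P * b * l / 2 \<le> P * (3 * b * (l - 1)\<^sup>2 / (l + 1))"
    by (simp add: mult.assoc)
  have nonneg: "0 \<le> b * l\<^sup>2" "0 \<le> (l - 1)\<^sup>2 * (l + 1) / 4"
    using b l by auto
  have "P * (4 * l - l\<^sup>2 - 3 * b * (l - 1)\<^sup>2 / (l + 1))
      = P * (l * (4 - l)) - P * (3 * b * (l - 1)\<^sup>2 / (l + 1))"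
    by (simp add: power2_eq_square right_diff_distrib mult_ac)
  then have main: "P * b * l / 2 < b\<^sup>2 + P * (l * (4 - l))"
    using less nonneg frac R by linarith
  show ?thesis
  proof (cases "4 \<le> l")
    case True
    then have "P * (l * (4 - l)) \<le> 0"
      using P l by (intro mult_nonneg_nonpos) auto
    then have "P * b * l / 2 < b\<^sup>2"
      using main by linarith
    then have "b * (P * l / 2) < b * b"
      by (simp add: power2_eq_square mult_ac)
    then have "P * l / 2 < b"
      using b by (rule mult_left_less_imp_less)
    then show ?thesis
      using b by linarith
  next
    case False
    \<comment> \<open>Now \<open>b * l \<ge> 16\<close>, so the positive term, at most
      \<open>4 * P\<close>, takes no more than half of \<open>P * b * l / 2\<close>.\<close>
    then have b8: "8 \<le> b"
      using large by linarith
    have "l * (4 - l) \<le> 4"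
      using zero_le_power2[of "l - 2"] by (simp add: power2_eq_square algebra_simps)
    then have "P * (l * (4 - l)) \<le> P * 4"
      using P by (intro mult_left_mono) auto
    moreover have "P * 8 * 2 \<le> P * b * l"
      using P b8 l by (intro mult_mono) auto
    ultimately have "P * b * l / 4 < b\<^sup>2"
      using main by linarith
    then have "b * (P * l / 4) < b * b"
      by (simp add: power2_eq_square mult_ac)
    then have "P * l / 4 < b"
      using b by (rule mult_left_less_imp_less)
    then show ?thesis
      by linarith
  qed
qed

section \<open>Counting Braess edges\<close>

lemma real_choose_two: "real (n choose 2) = real n * (real n - 1) / 2"
proof -
  have "even (n * (n - 1))"
    by (cases "even n") auto
  then have "real (n * (n - 1) div 2) = real (n * (n - 1)) / 2"
    by (simp add: real_of_nat_div)
  then show ?thesis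
    by (cases n) (simp_all add: choose_two algebra_simps)
qed

lemma real_div_bounds:
  fixes n d :: nat
  assumes "0 < d"
  shows "real (n div d) \<le> real n / real d" and "real n / real d \<le> real (n div d) + 1"
proof -
  have "real n = real (n div d) * real d + real (n mod d)"
    by (metis div_mult_mod_eq of_nat_add of_nat_mult)
  moreover have "real (n mod d) \<le> real d"
    using assms by (simp add: less_imp_le)
  ultimately show "real (n div d) \<le> real n / real d" and "real n / real d \<le> real (n div d) + 1"
    using assms by (auto simp: pos_le_divide_eq pos_divide_le_eq distrib_right)
qed

lemma harm_le_ln: "1 \<le> n \<Longrightarrow> (harm n :: real) \<le> 1 + ln (real n)"
proof (induction n rule: dec_induct)
  case base
  then show ?case by (simp add: harm_expand)
next
  case (step n)
  then show ?case
    using decseqD[OF decseq_harm_diff_ln, of "n - 1" n] by simp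
qed

lemma mem_braess_edges_between_iff:
  "e \<in> braess_edges_between V E A B \<longleftrightarrow> (\<exists>u\<in>A. \<exists>v\<in>B. e = {u, v} \<and> u \<in> V \<and> v \<in> V \<and> u \<noteq> v \<and> {u, v} \<notin> E
     \<and> kemeny V E < kemeny V (insert {u, v} E))"
  unfolding braess_edges_between_def braess_edges_def
  by (auto simp: doubleton_eq_iff; metis insert_commute)

section \<open>Counting the Braess edges of each kind\<close>

context broom
begin

text \<open>The centre is adjacent to every pendent vertex, so the nonadjacent pairs of the star
  part are the pairs of pendent vertices, all Braess by \<open>pendents_braess\<close>.\<close>

lemma B1_eq:
  assumes "3 \<le> k"
  shows "real (broom_B1 k p) = real p * (real p - 1) / 2"
proof -
  have "braess_edges_between V E (broom_star k p) (broom_star k p) = {e. e \<subseteq> {k+1..k+p} \<and> card e = 2}"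
  proof (intro set_eqI iffI)
    fix e assume "e \<in> braess_edges_between V E (broom_star k p) (broom_star k p)"
    then obtain u v where uv: "u \<in> broom_star k p" "v \<in> broom_star k p" "e = {u, v}" "u \<noteq> v" "{u, v} \<notin> E"
      unfolding mem_braess_edges_between_iff by blast
    then show "e \<in> {e. e \<subseteq> {k+1..k+p} \<and> card e = 2}"
      by (auto simp: broom_star_def broom_pendents_def edge_iff)
  next
    fix e assume "e \<in> {e. e \<subseteq> {k+1..k+p} \<and> card e = 2}"
    then obtain u v where uv: "e = {u, v}" "u \<in> {k+1..k+p}" "v \<in> {k+1..k+p}" "u \<noteq> v"
      by (auto simp: card_2_iff)
    moreover have "{u, v} \<notin> E"
      using uv by (auto simp: edge_iff)
    moreover have "u \<in> V" "v \<in> V" "u \<in> broom_star k p" "v \<in> broom_star k p"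
      using uv by (auto simp: mem_V broom_star_def broom_pendents_def)
    ultimately show "e \<in> braess_edges_between V E (broom_star k p) (broom_star k p)"
      unfolding mem_braess_edges_between_iff using pendents_braess[OF uv(2-4) assms] by blast
  qed
  then show ?thesis
    by (simp add: broom_B1_def n_subsets real_choose_two)
qed

text \<open>Only the \<open>N\<close> smallest distances \<open>l\<close> can occur, each with
  \<open>p\<close> choices of \<open>v\<close>. The denominator \<open>p - 1\<close> in
  \<open>N\<close> compensates the factor \<open>p\<close>, since
  \<open>p \<le> 2 * (p - 1)\<close>.\<close>

lemma B2_le:
  assumes k13: "13 \<le> k" and p2: "2 \<le> p"
  shows "broom_B2 k p \<le> 8 * k"
proof -
  define N where "N = 4 * k div (p - 1)"
  let ?B = "braess_edges_between V E (broom_path k) (broom_pendents k p)"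
  have "?B \<subseteq> (\<lambda>(l, v). {k + 1 - l, v}) ` ({1..N} \<times> {k+1..k+p})"
  proof
    fix e assume "e \<in> ?B"
    then obtain u v where uv: "u \<in> {1..k}" "v \<in> {k+1..k+p}" "e = {u, v}" "{u, v} \<notin> E"
        and less: "kemeny V E < kemeny V (insert {u, v} E)"
      unfolding mem_braess_edges_between_iff broom_path_def broom_pendents_def by blast
    have u: "1 \<le> u" "u < k"
      using uv by (auto simp: edge_iff le_less)
    define l where "l = k + 1 - u"
    have l: "real l = real k + 1 - real u"
      using u by (simp add: l_def of_nat_diff)
    have "(real p - 1) * real l < 4 * (real u - 1)"
    proof (rule path_pendent_necessary[OF _ _ _ _ _ less[unfolded path_pendent_braess_iff[OF u uv(2)], folded l]])
      show "0 \<le> (real p - 1) * ((real k)\<^sup>2 + 3 * (real p - 1) + 2) / (real k - 1 + real p)"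
        using k p by (intro divide_nonneg_nonneg mult_nonneg_nonneg add_nonneg_nonneg) auto
    qed (use u k13 p2 l in auto)
    moreover have "real u < real k"
      using u by simp
    ultimately have "(real p - 1) * real l \<le> 4 * real k"
      by (elim order.trans[OF less_imp_le]) simp
    then have "real ((p - 1) * l) \<le> real (4 * k)"
      using p2 by (simp add: of_nat_diff)
    then have "(p - 1) * l \<le> 4 * k"
      by (simp only: of_nat_le_iff)
    then have "l \<le> N"
      unfolding N_def using p2 by (simp add: less_eq_div_iff_mult_less_eq mult.commute)
    moreover have "1 \<le> l" "u = k + 1 - l"
      using u by (auto simp: l_def)
    ultimately show "e \<in> (\<lambda>(l, v). {k + 1 - l, v}) ` ({1..N} \<times> {k+1..k+p})"
      using uv by (auto intro!: image_eqI[of _ _ "(l, v)"])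
  qed
  then have "card ?B \<le> card ((\<lambda>(l, v). {k + 1 - l, v}) ` ({1..N} \<times> {k+1..k+p}))"
    by (rule card_mono[rotated]) simp
  also have "\<dots> \<le> card ({1..N} \<times> {k+1..k+p})"
    by (rule card_image_le) simp
  also have "\<dots> = N * p"
    by simp
  also have "\<dots> \<le> N * (2 * (p - 1))"
    using p2 by (intro mult_left_mono) auto
  also have "\<dots> \<le> 8 * k"
    using div_times_less_eq_dividend[of "4 * k" "p - 1"] by (simp add: N_def)
  finally show ?thesis
    by (simp add: broom_B2_def)
qed

lemma mem_B3_iff:
  "e \<in> braess_edges_between V E (broom_path k) (broom_path k) \<longleftrightarrow>
    (\<exists>u v. e = {u, v} \<and> 1 \<le> u \<and> u + 2 \<le> v \<and> v \<le> k \<and> kemeny V E < kemeny V (insert {u, v} E))"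
  (is "_ \<longleftrightarrow> ?R")
proof
  assume "e \<in> braess_edges_between V E (broom_path k) (broom_path k)"
  then obtain u v where uv: "u \<in> {1..k}" "v \<in> {1..k}" "e = {u, v}" "u \<noteq> v" "{u, v} \<notin> E"
      "kemeny V E < kemeny V (insert {u, v} E)"
    unfolding mem_braess_edges_between_iff broom_path_def by blast
  then have "u + 2 \<le> v \<or> v + 2 \<le> u"
    by (auto simp: edge_iff)
  then show ?R
  proof
    assume "u + 2 \<le> v"
    then show ?R using uv by (intro exI[of _ u] exI[of _ v]) auto
  next
    assume "v + 2 \<le> u"
    then show ?R using uv by (intro exI[of _ v] exI[of _ u]) (auto simp: insert_commute)
  qed
next
  assume ?R
  then obtain u v where uv: "e = {u, v}" "1 \<le> u" "u + 2 \<le> v" "v \<le> k" "kemeny V E < kemeny V (insert {u, v} E)"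
    by blast
  moreover have "u \<in> V" "v \<in> V" "{u, v} \<notin> E" "u \<noteq> v" "u \<in> {1..k}" "v \<in> {1..k}"
    using uv by (auto simp: mem_V edge_iff)
  ultimately show "e \<in> braess_edges_between V E (broom_path k) (broom_path k)"
    unfolding mem_braess_edges_between_iff broom_path_def by blast
qed

text \<open>A Braess chord is determined by \<open>l\<close> together with \<open>b\<close> or
  \<open>c\<close>, one of which is at most \<open>3 * k div l\<close>. Summing over
  \<open>l\<close> gives a harmonic sum for each of the two cases.\<close>

lemma B3_le: "real (broom_B3 k p) \<le> 6 * real k * (1 + ln (real k)) + 2 * real k"
proof -
  let ?B = "braess_edges_between V E (broom_path k) (broom_path k)"
  let ?T = "Sigma {2..k} (\<lambda>l. {..3 * k div l})"
  let ?L = "(\<lambda>(l, b). {b + 1, b + 1 + l}) ` ?T" and ?R = "(\<lambda>(l, c). {k - c - l, k - c}) ` ?T"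
  have "?B \<subseteq> ?L \<union> ?R"
  proof
    fix e assume "e \<in> ?B"
    then obtain u v where uv: "e = {u, v}" "1 \<le> u" "u + 2 \<le> v" "v \<le> k"
        and less: "kemeny V E < kemeny V (insert {u, v} E)"
      unfolding mem_B3_iff by blast
    define b l c where "b = u - 1" and "l = v - u" and "c = k - v"
    have real: "real b = real u - 1" "real l = real v - real u" "real c = real k - real v"
      using uv by (auto simp: b_def l_def c_def of_nat_diff)
    have m: "real k - 1 + real p = real b + real l + real c + real p"
      using real by simp
    have *: "real b * real l \<le> 3 * (real b + real l + real c) + 1 \<or> real c * real l \<le> 3 * (real b + real l + real c) + 1"
      by (rule path_chord_necessary[OF _ _ _ _ less[unfolded path_braess_iff[OF uv(2-4)], folded real, unfolded m]])
        (use uv p in \<open>auto simp: l_def\<close>)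
    \<comment> \<open>Here \<open>b + l + c = k - 1\<close>.\<close>
    have "3 * (real b + real l + real c) + 1 \<le> real (3 * k)"
      using real by simp
    then have "real (b * l) \<le> real (3 * k) \<or> real (c * l) \<le> real (3 * k)"
      unfolding of_nat_mult[of b] of_nat_mult[of c] using * order_trans by blast
    then have "b * l \<le> 3 * k \<or> c * l \<le> 3 * k"
      by (simp only: of_nat_le_iff)
    moreover have l2: "2 \<le> l" "l \<le> k"
      using uv by (auto simp: l_def)
    ultimately have "b \<le> 3 * k div l \<or> c \<le> 3 * k div l"
      by (simp add: less_eq_div_iff_mult_less_eq)
    moreover have "u = b + 1" "v = b + 1 + l" "u = k - c - l" "v = k - c"
      using uv by (auto simp: b_def l_def c_def)
    ultimately show "e \<in> ?L \<union> ?R"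
      using uv(1) l2 by (auto intro: image_eqI[of _ _ "(l, b)"] image_eqI[of _ _ "(l, c)"])
  qed
  then have "card ?B \<le> card (?L \<union> ?R)"
    by (rule card_mono[rotated]) simp
  also have "\<dots> \<le> card ?L + card ?R"
    by (rule card_Un_le)
  also have "\<dots> \<le> card ?T + card ?T"
    by (intro add_mono card_image_le) auto
  finally have "broom_B3 k p \<le> 2 * card ?T"
    unfolding broom_B3_def mult_2 .
  then have "real (broom_B3 k p) \<le> real (2 * card ?T)"
    by (simp only: of_nat_le_iff)
  then have "real (broom_B3 k p) \<le> 2 * real (card ?T)"
    unfolding of_nat_mult of_nat_numeral .
  also have "real (card ?T) = (\<Sum>l=2..k. real (3 * k div l) + 1)"
    by (simp add: add.commute)
  also have "\<dots> \<le> (\<Sum>l=2..k. 3 * real k * inverse (real l) + 1)"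
    by (intro sum_mono add_right_mono) (use real_div_bounds(1)[of _ "3 * k"] in \<open>auto simp: divide_inverse\<close>)
  also have "\<dots> \<le> (\<Sum>l=1..k. 3 * real k * inverse (real l) + 1)"
    by (intro sum_mono2) auto
  also have "\<dots> = 3 * real k * harm k + real k"
    by (simp add: sum.distrib harm_def sum_distrib_left)
  also have "\<dots> \<le> 3 * real k * (1 + ln (real k)) + real k"
    using k harm_le_ln[of k] by (intro add_right_mono mult_left_mono) auto
  finally show ?thesis by simp
qed

lemma B3_ge:
  fixes a :: real
  assumes k6: "6 \<le> k"
  defines "a \<equiv> real k - 1"
  shows "a / 9 * (ln (a / 5) / 2 - 1) \<le> real (broom_B3 k p)"
proof -
  \<comment> \<open>The largest \<open>l\<close> with \<open>5 * l\<^sup>2 \<le> a\<close>.\<close>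
  define L where "L = nat \<lfloor>sqrt (a / 5)\<rfloor>"
  let ?B = "braess_edges_between V E (broom_path k) (broom_path k)"
  let ?T = "Sigma {2..L} (\<lambda>l. {..(k - 1) div (9 * l)})"
  have a: "5 \<le> a" "a = real (k - 1)"
    using k6 by (auto simp: a_def of_nat_diff)
  have L: "real L \<le> sqrt (a / 5)" "sqrt (a / 5) \<le> real L + 1"
    using a by (auto simp: L_def intro: real_sqrt_ge_0_iff)
  have inj: "inj_on (\<lambda>(l, b :: nat). {b + 1, b + 1 + l}) ?T"
    by (auto simp: inj_on_def doubleton_eq_iff)
  have sub: "(\<lambda>(l, b). {b + 1, b + 1 + l}) ` ?T \<subseteq> ?B"
  proof
    fix e assume "e \<in> (\<lambda>(l, b). {b + 1, b + 1 + l}) ` ?T"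
    then obtain l b where e: "e = {b + 1, b + 1 + l}" and l: "2 \<le> l" "l \<le> L" and b: "b \<le> (k - 1) div (9 * l)"
      by auto
    have "b * (9 * l) \<le> k - 1"
      using b l by (simp add: less_eq_div_iff_mult_less_eq)
    then have "real (b * (9 * l)) \<le> real (k - 1)"
      by (simp only: of_nat_le_iff)
    then have b': "9 * real b * real l \<le> a"
      using a by (simp add: mult_ac)
    have "real l \<le> sqrt (a / 5)"
      using l L by linarith
    then have "(real l)\<^sup>2 \<le> (sqrt (a / 5))\<^sup>2"
      by (rule power_mono) simp
    then have l': "5 * (real l)\<^sup>2 \<le> a"
      using a by simp
    \<comment> \<open>The chord must fit on the path: these bounds give
      \<open>l \<le> a / 10\<close> and \<open>b \<le> a / 18\<close>.\<close>
    have "2 * real l \<le> (real l)\<^sup>2" "18 * real b \<le> 9 * real b * real l"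
      using l mult_left_mono[of 2 "real l" "9 * real b"] by (auto simp: power2_eq_square)
    then have "real b + real l \<le> a"
      using b' l' by linarith
    then have "real (b + l) \<le> real (k - 1)"
      using a by simp
    then have bl: "b + 1 + l \<le> k"
      using k6 by (simp only: of_nat_le_iff)
    define c where "c = k - (b + 1 + l)"
    have real: "real (b + 1) - 1 = real b" "real (b + 1 + l) - real (b + 1) = real l"
        "real k - real (b + 1 + l) = real c"
      using bl by (auto simp: c_def of_nat_diff)
    have eq: "a = real b + real l + real c" "real k - 1 + real p = real b + real l + real c + real p"
      using bl by (auto simp: c_def of_nat_diff a_def)
    have uv: "1 \<le> b + 1" "b + 1 + 2 \<le> b + 1 + l"
      using l by auto
    have "kemeny V E < kemeny V (insert {b + 1, b + 1 + l} E)"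
      unfolding path_braess_iff[OF uv bl] real eq(2)
      by (rule path_chord_sufficient) (use l p l' b' in \<open>auto simp: eq(1)\<close>)
    then show "e \<in> ?B"
      unfolding mem_B3_iff using e uv bl by blast
  qed
  have fin: "finite ?B"
    by (rule finite_subset[of _ "Pow V"]) (auto simp: mem_braess_edges_between_iff V_eq)
  have "card ?T \<le> broom_B3 k p"
    unfolding broom_B3_def card_image[OF inj, symmetric] by (rule card_mono[OF fin sub])
  moreover have "a / 9 * (harm L - 1) \<le> real (card ?T)"
  proof (cases "L = 0")
    case True
    then show ?thesis using a by (simp add: harm_expand)
  next
    case False
    then have "{1..L} = insert 1 {2..L}"
      by auto
    then have "a / 9 * (harm L - 1) = (\<Sum>l=2..L. a / 9 * inverse (real l))"
      by (simp add: harm_def sum_distrib_left)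
    \<comment> \<open>The set \<open>{..n}\<close> has \<open>n + 1\<close> elements, which makes up
      for the rounding in \<open>div\<close>.\<close>
    also have "\<dots> \<le> (\<Sum>l=2..L. real ((k - 1) div (9 * l)) + 1)"
    proof (rule sum_mono)
      fix l assume l: "l \<in> {2..L}"
      then have "real (k - 1) / real (9 * l) \<le> real ((k - 1) div (9 * l)) + 1"
        by (intro real_div_bounds) auto
      moreover have "a / 9 * inverse (real l) = real (k - 1) / real (9 * l)"
        using l unfolding a(2) by (simp add: field_simps)
      ultimately show "a / 9 * inverse (real l) \<le> real ((k - 1) div (9 * l)) + 1"
        by linarith
    qed
    also have "\<dots> = real (card ?T)"
      by (simp add: add.commute)
    finally show ?thesis .
  qed
  moreover have "ln (a / 5) / 2 \<le> harm L"
  proof -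
    have "ln (a / 5) / 2 = ln (sqrt (a / 5))"
      using a by (simp add: ln_sqrt)
    also have "\<dots> \<le> ln (real L + 1)"
      using L a by simp
    also have "\<dots> \<le> harm L"
      by (rule ln_le_harm)
    finally show ?thesis .
  qed
  then have "a / 9 * (ln (a / 5) / 2 - 1) \<le> a / 9 * (harm L - 1)"
    using a by (intro mult_left_mono) auto
  ultimately show ?thesis
    by linarith
qed

section \<open>The total number of Braess edges\<close>

lemma finite_braess_edges: "finite (braess_edges V E)"
  by (rule finite_subset[of _ "Pow V"]) (auto simp: braess_edges_def V_eq)

lemma B_le: "broom_B k p \<le> broom_B1 k p + broom_B2 k p + broom_B3 k p"
proof -
  let ?S = "braess_edges_between V E"
  have "braess_edges V E \<subseteq> ?S (broom_star k p) (broom_star k p) \<union> ?S (broom_path k) (broom_pendents k p)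
      \<union> ?S (broom_path k) (broom_path k)"
  proof
    fix e assume e: "e \<in> braess_edges V E"
    then obtain u v where uv: "e = {u, v}" "u \<in> V" "v \<in> V"
      by (auto simp: braess_edges_def)
    then have "(u \<in> broom_path k \<or> u \<in> broom_pendents k p) \<and> (v \<in> broom_path k \<or> v \<in> broom_pendents k p)"
      using k by (auto simp: broom_verts_def broom_star_def broom_path_def)
    then show "e \<in> ?S (broom_star k p) (broom_star k p) \<union> ?S (broom_path k) (broom_pendents k p)
      \<union> ?S (broom_path k) (broom_path k)"
      using e uv(1) insert_commute[of u v "{}"] unfolding braess_edges_between_def broom_star_def by blast
  qed
  moreover have "finite (?S A B)" for A B
    using finite_braess_edges by (simp add: braess_edges_between_def)
  ultimately have "broom_B k p \<le> card (?S (broom_star k p) (broom_star k p)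
      \<union> ?S (broom_path k) (broom_pendents k p) \<union> ?S (broom_path k) (broom_path k))"
    unfolding broom_B_def by (intro card_mono) auto
  also have "\<dots> \<le> broom_B1 k p + broom_B2 k p + broom_B3 k p"
    unfolding broom_B1_def broom_B2_def broom_B3_def
    by (intro order_trans[OF card_Un_le] add_right_mono card_Un_le)
  finally show ?thesis .
qed

lemma B1_le_B: "broom_B1 k p \<le> broom_B k p" and B3_le_B: "broom_B3 k p \<le> broom_B k p"
  unfolding broom_B_def broom_B1_def broom_B3_def
  using finite_braess_edges by (auto simp: braess_edges_between_def intro: card_mono)

end

section \<open>Asymptotics as the path length tends to infinity\<close>

theorem theorem5p1:
  fixes p :: "nat \<Rightarrow> nat" and \<beta> :: ereal
  assumes "\<And>k. k \<ge> 3 \<Longrightarrow> p k \<ge> 2"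
    and "0 \<le> \<beta>"
    and "(\<lambda>k. ereal (real (p k) / real k)) \<longlonglongrightarrow> \<beta>"
  shows "(\<forall>k\<ge>3. real (broom_B1 k (p k)) = real (p k) * (real (p k) - 1) / 2) \<and>
    (\<lambda>k. real (broom_B2 k (p k))) \<in> O[at_top](\<lambda>k. real k) \<and>
    (\<lambda>k. real (broom_B3 k (p k))) \<in> \<Theta>[at_top](\<lambda>k. real k * ln (real k)) \<and>
    (\<beta> = 0 \<longrightarrow>
      (\<lambda>k. real (broom_B k (p k))) \<in> \<Theta>[at_top](\<lambda>k. real k * ln (real k) + (real (p k))\<^sup>2)) \<and>
    (0 < \<beta> \<longrightarrow>
      (\<lambda>k. real (broom_B k (p k))) \<sim>[at_top] (\<lambda>k. (real (p k))\<^sup>2 / 2))"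
proof -
  have broom: "broom k (p k)" if "3 \<le> k" for k
    by unfold_locales (use that assms(1)[OF that] in auto)
  have B1: "real (broom_B1 k (p k)) = real (p k) * (real (p k) - 1) / 2" if "3 \<le> k" for k
    using broom.B1_eq[OF broom] that by blast
  have B1_bounds: "(real (p k))\<^sup>2 / 2 - real (p k) / 2 \<le> real (broom_B k (p k))" "(real (p k))\<^sup>2 \<le> 4 * real (broom_B k (p k))"
    if "3 \<le> k" for k
  proof -
    have "real (broom_B1 k (p k)) \<le> real (broom_B k (p k))"
      using broom.B1_le_B[OF broom] that by simp
    moreover have "real (broom_B1 k (p k)) = (real (p k))\<^sup>2 / 2 - real (p k) / 2"
      using B1[OF that] by (simp add: power2_eq_square field_simps)
    moreover have "2 * real (p k) \<le> (real (p k))\<^sup>2"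
      using assms(1)[OF that] by (simp add: power2_eq_square)
    ultimately show "(real (p k))\<^sup>2 / 2 - real (p k) / 2 \<le> real (broom_B k (p k))" "(real (p k))\<^sup>2 \<le> 4 * real (broom_B k (p k))"
      by linarith+
  qed
  \<comment> \<open>From 13 on, \<open>B2_le\<close> applies and \<open>ln k \<ge> 1\<close>, so
    terms linear in \<open>k\<close> are absorbed by \<open>k * ln k\<close>.\<close>
  have large: "\<forall>\<^sub>F k in at_top. 13 \<le> (k :: nat)"
    by (rule eventually_ge_at_top)
  have ln: "1 \<le> ln (real k)" if "13 \<le> k" for k :: nat
  proof -
    have "exp 1 \<le> real k"
      using exp_le that by simp
    then show ?thesis
      using that by (subst ln_ge_iff) auto
  qed
  have B2: "real (broom_B2 k (p k)) \<le> 8 * real k" if "13 \<le> k" for k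
  proof -
    have "broom_B2 k (p k) \<le> 8 * k"
      using that assms(1)[of k] by (intro broom.B2_le[OF broom]) auto
    then have "real (broom_B2 k (p k)) \<le> real (8 * k)"
      by (simp only: of_nat_le_iff)
    then show ?thesis by simp
  qed
  have B3: "real (broom_B3 k (p k)) \<le> 14 * (real k * ln (real k))" if "13 \<le> k" for k
  proof -
    have "real (broom_B3 k (p k)) \<le> 6 * real k * (1 + ln (real k)) + 2 * real k"
      using broom.B3_le[OF broom] that by simp
    moreover have "real k * 1 \<le> real k * ln (real k)"
      using ln[OF that] by (intro mult_left_mono) auto
    ultimately show ?thesis
      by (simp add: algebra_simps)
  qed
  \<comment> \<open>The constant 22 is 8 from \<open>B2\<close> plus 14 from
    \<open>B3\<close>.\<close>
  have B_le: "real (broom_B k (p k)) \<le> (real (p k))\<^sup>2 / 2 + 22 * (real k * ln (real k))" if "13 \<le> k" for k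
  proof -
    have "real (broom_B k (p k)) \<le> real (broom_B1 k (p k)) + real (broom_B2 k (p k)) + real (broom_B3 k (p k))"
      using broom.B_le[OF broom, of k] that by (simp flip: of_nat_add)
    moreover have "real (broom_B1 k (p k)) \<le> (real (p k))\<^sup>2 / 2"
      using B1[of k] that by (simp add: power2_eq_square field_simps)
    moreover have "real k * 1 \<le> real k * ln (real k)"
      using ln[OF that] by (intro mult_left_mono) auto
    ultimately show ?thesis
      using B2[OF that] B3[OF that] by linarith
  qed
  have B2_bigo: "(\<lambda>k. real (broom_B2 k (p k))) \<in> O[at_top](\<lambda>k. real k)"
    by (rule bigoI[of _ 8], use large in eventually_elim) (use B2 in simp)
  \<comment> \<open>The lower bound of \<open>B3_ge\<close>; it does not involve
    \<open>p\<close>.\<close>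
  let ?h = "\<lambda>k::nat. (real k - 1) / 9 * (ln ((real k - 1) / 5) / 2 - 1)"
  have "(\<lambda>k. real k * ln (real k)) \<in> O[at_top](?h)"
    by real_asymp
  moreover have "?h \<in> O[at_top](\<lambda>k. real (broom_B3 k (p k)))"
  proof (rule landau_o.big_mono)
    have "\<forall>\<^sub>F k in at_top. 0 \<le> ?h k"
      by real_asymp
    with large show "\<forall>\<^sub>F k in at_top. norm (?h k) \<le> norm (real (broom_B3 k (p k)))"
      by eventually_elim (use broom.B3_ge[OF broom] in auto)
  qed
  ultimately have B3_lower: "(\<lambda>k. real k * ln (real k)) \<in> O[at_top](\<lambda>k. real (broom_B3 k (p k)))"
    by (rule landau_o.big_trans)
  have B3_upper: "(\<lambda>k. real (broom_B3 k (p k))) \<in> O[at_top](\<lambda>k. real k * ln (real k))"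
    by (rule bigoI[of _ 14], use large in eventually_elim) (use B3 ln in \<open>force simp: abs_mult\<close>)
  have B3_theta: "(\<lambda>k. real (broom_B3 k (p k))) \<in> \<Theta>[at_top](\<lambda>k. real k * ln (real k))"
    using B3_lower B3_upper by (simp add: bigtheta_def bigomega_iff_bigo)
  have B_theta: "(\<lambda>k. real (broom_B k (p k))) \<in> \<Theta>[at_top](\<lambda>k. real k * ln (real k) + (real (p k))\<^sup>2)"
  proof (rule bigthetaI)
    show "(\<lambda>k. real (broom_B k (p k))) \<in> O[at_top](\<lambda>k. real k * ln (real k) + (real (p k))\<^sup>2)"
    proof (rule bigoI[of _ 22], use large in eventually_elim)
      case (elim k)
      have "0 \<le> real k * ln (real k)" "0 \<le> (real (p k))\<^sup>2"
        using ln[OF elim] by auto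
      moreover from this have "real (broom_B k (p k)) \<le> 22 * (real k * ln (real k) + (real (p k))\<^sup>2)"
        using B_le[OF elim] unfolding distrib_left by linarith
      ultimately show ?case
        by (simp only: real_norm_def abs_of_nonneg of_nat_0_le_iff add_nonneg_nonneg)
    qed
    have "(\<lambda>k. real (broom_B3 k (p k))) \<in> O[at_top](\<lambda>k. real (broom_B k (p k)))"
      by (rule landau_o.big_mono, use large in eventually_elim) (use broom.B3_le_B[OF broom] in simp)
    then have "(\<lambda>k. real k * ln (real k)) \<in> O[at_top](\<lambda>k. real (broom_B k (p k)))"
      using B3_lower landau_o.big_trans by blast
    moreover have "(\<lambda>k. (real (p k))\<^sup>2) \<in> O[at_top](\<lambda>k. real (broom_B k (p k)))"
      by (rule bigoI[of _ 4], use large in eventually_elim) (use B1_bounds in simp)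
    ultimately show "(\<lambda>k. real (broom_B k (p k))) \<in> \<Omega>[at_top](\<lambda>k. real k * ln (real k) + (real (p k))\<^sup>2)"
      unfolding bigomega_iff_bigo by (rule sum_in_bigo)
  qed
  have B_equiv: "(\<lambda>k. real (broom_B k (p k))) \<sim>[at_top] (\<lambda>k. (real (p k))\<^sup>2 / 2)" if \<beta>: "0 < \<beta>"
  proof -
    \<comment> \<open>A real \<open>c\<close> between 0 and \<open>\<beta>\<close> exists also for
      infinite \<open>\<beta>\<close>. Eventually \<open>p k \<ge> c * k\<close>, so
      \<open>k * ln k\<close> is negligible against the square of \<open>p k\<close>, and the ratio
      is squeezed between two expressions tending to 1.\<close>
    obtain c where c: "0 < ereal c" "ereal c < \<beta>"
      using ereal_dense2[OF \<beta>] by blast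
    then have c0: "0 < c"
      by simp
    have "\<forall>\<^sub>F k in at_top. ereal c < ereal (real (p k) / real k)"
      using order_tendstoD(1)[OF assms(3) c(2)] .
    with large have p_ge: "\<forall>\<^sub>F k in at_top. 13 \<le> k \<and> c * real k \<le> real (p k)"
      by eventually_elim (auto simp: field_simps)
    show ?thesis
    proof (rule asymp_equivI', rule tendsto_sandwich)
      show "\<forall>\<^sub>F k in at_top. 1 - 1 / (c * real k) \<le> real (broom_B k (p k)) / ((real (p k))\<^sup>2 / 2)"
        using p_ge
      proof eventually_elim
        case (elim k)
        then have k: "3 \<le> k" "0 < c * real k" "c * real k \<le> real (p k)" "0 < real (p k)"
          using c0 assms(1)[of k] by auto
        have "1 / real (p k) \<le> 1 / (c * real k)"
          using k by (intro divide_left_mono) auto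
        moreover have "1 - 1 / real (p k) = ((real (p k))\<^sup>2 / 2 - real (p k) / 2) / ((real (p k))\<^sup>2 / 2)"
          using k by (simp add: field_simps power2_eq_square)
        moreover have "\<dots> \<le> real (broom_B k (p k)) / ((real (p k))\<^sup>2 / 2)"
          using B1_bounds(1)[OF k(1)] by (intro divide_right_mono) auto
        ultimately show ?case by linarith
      qed
      show "\<forall>\<^sub>F k in at_top. real (broom_B k (p k)) / ((real (p k))\<^sup>2 / 2)
          \<le> 1 + 44 * (real k * ln (real k)) / (c * real k)\<^sup>2"
        using p_ge
      proof eventually_elim
        case (elim k)
        then have k: "0 < c * real k" "c * real k \<le> real (p k)" "0 < real (p k)" "0 \<le> real k * ln (real k)"
          using c0 assms(1)[of k] ln[of k] by auto
        have "real (broom_B k (p k)) / ((real (p k))\<^sup>2 / 2)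
            \<le> ((real (p k))\<^sup>2 / 2 + 22 * (real k * ln (real k))) / ((real (p k))\<^sup>2 / 2)"
          using B_le elim by (intro divide_right_mono) auto
        also have "\<dots> = 1 + 44 * (real k * ln (real k)) / (real (p k))\<^sup>2"
          using k by (simp add: field_simps)
        also have "\<dots> \<le> 1 + 44 * (real k * ln (real k)) / (c * real k)\<^sup>2"
          using k c0 elim by (intro add_left_mono divide_left_mono power_mono mult_pos_pos zero_less_power) auto
        finally show ?case .
      qed
      show "(\<lambda>k. 1 - 1 / (c * real k)) \<longlonglongrightarrow> 1"
        using c0 by real_asymp
      show "(\<lambda>k. 1 + 44 * (real k * ln (real k)) / (c * real k)\<^sup>2) \<longlonglongrightarrow> 1"
        using c0 by real_asymp
    qed
  qed
  show ?thesis
    using B1 B2_bigo B3_theta B_theta B_equiv by blast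
qed

end
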